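(* Let $M$ be a complex manifold, $w\in\mathbb Z$, and let $(K,C,\mathcal U,g,\kappa,h,D,\mathcal Q)$ be a CV-structure and $(K,C,\mathcal U,g,\nabla^r,\mathcal V)$ a Saito structure which share the same data $(K\to M,C,\mathcal U,g)$. Then the two structures form a harmonic potential real Saito structure if and only if the $A(0)$-condition holds.
   Context: **CV-structure.** A CV-structure is a tuple $(K\to M,C,\mathcal U,g,\kappa,h,D,\mathcal Q)$ where: - $K\to M$ is a holomorphic vector bundle, $C\in\Omega^1_M\otimes\mathcal O(\mathrm{End}K)$ and $\mathcal U\in\mathcal O(\mathrm{End}K)$ are holomorphic, $g$ is a holomorphic symmetric non-degenerate bilinear form on $K$, with, for holomorphic vector fields $X,Y$, ( * ) $C_XC_Y=C_YC_X$, $[C_X,\mathcal U]=0$, $g(C_Xa,b)=g(a,C_Xb)$, $g(\mathcal U a,b)=g(a,\mathcal U b)$; - $\kappa:K\to K$ is a smooth fibrewise $\mathbb C$-antilinear bundle map, $\kappa^2=\mathrm{id}$, $g(\kappa a,\kappa b)=\overline{g(a,b)}$; - $h:=g(\cdot,\kappa\cdot)$ is a non-degenerate (possibly indefinite) hermitian form, linear in the first and conjugate linear in the second argument, and its Chern connection $D$ satisfies: $D(\kappa)=0$ (i.e. $D_X(\kappa a)=\kappa D_{\bar X}a$), $D_X(C_Y)-D_Y(C_X)-C_{[X,Y]}=0$, and $R^D(X,\bar Y)+[C_X,\kappa C_Y\kappa]=0$, where $R^D$ is the curvature of $D$; - $\mathcal Q$ is a smooth endomorphism of $K$ with $g(\mathcal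 Qa,b)=-g(a,\mathcal Qb)$, $h(\mathcal Qa,b)=h(a,\mathcal Qb)$, $D_X(\mathcal U)-[C_X,\mathcal Q]+C_X=0$, $D_X(\mathcal Q)+[C_X,\kappa\,\mathcal U\kappa]=0$. **Saito structure.** A tuple $(K\to M,C,\mathcal U,g,\nabla^r,\mathcal V)$ with $K,C,\mathcal U,g$ holomorphic as in the first item (including ( * )), $\nabla^r$ a flat holomorphic connection on $K$, $\mathcal V\in\mathcal O(\mathrm{End}K)$, such that $\nabla^r(\mathcal V)=0$, $\nabla^r_X(C_Y)-\nabla^r_Y(C_X)-C_{[X,Y]}=0$, $\nabla^r_X(\mathcal U)-[C_X,\mathcal V]+C_X=0$, $\nabla^r(g)=0$, $g(\mathcal Va,b)+g(a,\mathcal Vb)=0$. The $(0,1)$-part of $\nabla^r$, viewed as a connection on the smooth bundle $K$, is the $\bar\partial$-operator of $K$. **Harmonic potential real Saito structure.** The two structures form such a structure if there is a smooth $g$-symmetric endomorphism $A$ of $K$ (not necessarily holomorphic) with $$D=\nabla^r-[A^\flat,C],\qquad \mathcal Q=\mathcal V-[\mathcal U,A^\flat],\qquad D_{\bar X}(A^\flat)=\kappa C_X\kappa\ \ (X \text{ of type }(1,0)),$$ where $A^\flat$ is the $h$-adjoint of $A$. **Associated connections.** Let $p:\mathbb C\times M\to M$ be the projection, $z$ the coordinate on $\mathbb C$, $U:=z\partial_z$. Data on $K$ are lifted to $p^*K$. For smooth sections $a,b$ of $K$ (lifted to $p^*K$) and $X$ of type $(1,0)$ on $M$, put - (Saito)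 $\nabla_Xa=\nabla^r_Xa+\frac1zC_Xa$, $\nabla_Ua=(\frac1z\mathcal U-\mathcal V+\frac w2)a$, $\nabla_{\bar X}a=\bar\partial_{\bar X}a$; - (CV) $\widehat\nabla_Xa=D_Xa+\frac1zC_Xa$, $\widehat\nabla_Ua=(\frac1z\mathcal U-\mathcal Q+\frac w2+z\kappa\,\mathcal U\kappa)a$, $\widehat\nabla_{\bar X}a=D_{\bar X}a+z\kappa C_X\kappa\,a$; - $P(a,b)=\widehat P(a,b)=z^wg(a,b)$. These operators are extended to Laurent series in $z$ with smooth sections of $K$ as coefficients by the Leibniz rule ($X,\bar X$ annihilate $z$, $U(z)=z$). The pairing pairs the fibre at $z$ with the fibre at $-z$: for $s=\sum z^is_i$, $\tilde s=\sum z^i\tilde s_i$, $P(s,\tilde s)=z^w\sum_{i,j}(-1)^jz^{i+j}g(s_i,\tilde s_j)$. **$A(k-1)$-condition** ($k\ge 0$). There is a formal automorphism $\Psi=\mathrm{id}+zA_1+z^2A_2+\cdots$ with smooth endomorphisms $A_i$ of $K$ such that for all smooth sections $a,b$ of $K$ and all $X$ of type $(1,0)$: $\widehat\nabla_X(\Psi a)=\Psi\nabla_Xa$, $\widehat\nabla_U(\Psi a)=\Psi\nabla_Ua$ and $z^{-w-1}\widehat P(\Psi a,\Psi b)=z^{-w-1}P(a,b)$ hold modulo terms $z^j$ with $j\ge k$, and $\widehat\nabla_{\bar X}(\Psi a)=\Psi\nabla_{\bar X}a$ holds modulo terms $z^j$ with $j\ge k+1$. The $A(0)$-condition is the case $k=1$.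 *)

theory Defs
  imports "HOL-Analysis.Analysis"
begin

section \<open>Functions of several complex variables\<close>

text \<open>
  The model space \<open>\<complex>\<^sup>d\<close> is the set of sequences vanishing from index \<open>d\<close> on, with the topology
  induced from the product topology. In this way \<open>d\<close> is an ordinary number, and \<open>d = 0\<close> is allowed.
\<close>

definition complex_space :: "nat \<Rightarrow> (nat \<Rightarrow> complex) set" where
  "complex_space d = {z. \<forall>i\<ge>d. z i = 0}"

text \<open>
  \<open>V\<close> is always an open subset of \<open>complex_space d\<close>. The directions \<open>c = 1\<close> and \<open>c = \<i>\<close> give the
  real partial derivatives with respect to \<open>Re z\<^sub>i\<close> and \<open>Im z\<^sub>i\<close>.
\<close>

primrec Ck_on :: "nat \<Rightarrow> nat \<Rightarrow> (nat \<Rightarrow> complex) set \<Rightarrow> ((nat \<Rightarrow> complex) \<Rightarrow> complex) \<Rightarrow> bool" where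
  "Ck_on d 0 V f \<longleftrightarrow> continuous_on V f"
| "Ck_on d (Suc k) V f \<longleftrightarrow> continuous_on V f \<and>
     (\<forall>i<d. \<forall>c\<in>{1, \<i>}. \<exists>f'. Ck_on d k V f' \<and>
        (\<forall>z\<in>V. ((\<lambda>t::real. f (z(i := z i + of_real t * c))) has_vector_derivative f' z) (at 0)))"

definition Cinf_on :: "nat \<Rightarrow> (nat \<Rightarrow> complex) set \<Rightarrow> ((nat \<Rightarrow> complex) \<Rightarrow> complex) \<Rightarrow> bool" where
  "Cinf_on d V f \<longleftrightarrow> (\<forall>k. Ck_on d k V f)"

text \<open>Holomorphic functions are the smooth ones satisfying the Cauchy-Riemann equations in each variable.\<close>

definition holo_on :: "nat \<Rightarrow> (nat \<Rightarrow> complex) set \<Rightarrow> ((nat \<Rightarrow> complex) \<Rightarrow> complex) \<Rightarrow> bool" where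
  "holo_on d V f \<longleftrightarrow> Cinf_on d V f \<and>
     (\<forall>z\<in>V. \<forall>i<d. (\<lambda>\<zeta>. f (z(i := \<zeta>))) field_differentiable at (z i))"

section \<open>Complex manifolds\<close>

record 'm cmanifold =
  mtop :: "'m topology"
  cdim :: nat
  atlas :: "('m set \<times> ('m \<Rightarrow> nat \<Rightarrow> complex)) set"

definition complex_manifold :: "('m, 'z) cmanifold_scheme \<Rightarrow> bool" where
  "complex_manifold M \<longleftrightarrow>
     Hausdorff_space (mtop M) \<and> second_countable (mtop M) \<and>
     (\<Union>(W, \<phi>)\<in>atlas M. W) = topspace (mtop M) \<and>
     (\<forall>(W, \<phi>)\<in>atlas M.
        openin (mtop M) W \<and>
        openin (top_of_set (complex_space (cdim M))) (\<phi> ` W) \<and>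
        homeomorphic_map (subtopology (mtop M) W) (top_of_set (\<phi> ` W)) \<phi>) \<and>
     (\<forall>(W, \<phi>)\<in>atlas M. \<forall>(W', \<phi>')\<in>atlas M. \<forall>i<cdim M.
        holo_on (cdim M) (\<phi> ` (W \<inter> W')) (\<lambda>z. \<phi>' (inv_into W \<phi> z) i))"

definition smooth_fun :: "('m, 'z) cmanifold_scheme \<Rightarrow> 'm set \<Rightarrow> ('m \<Rightarrow> complex) \<Rightarrow> bool" where
  "smooth_fun M S f \<longleftrightarrow> openin (mtop M) S \<and>
     (\<forall>(W, \<phi>)\<in>atlas M. Cinf_on (cdim M) (\<phi> ` (S \<inter> W)) (\<lambda>z. f (inv_into W \<phi> z)))"

definition holo_fun :: "('m, 'z) cmanifold_scheme \<Rightarrow> 'm set \<Rightarrow> ('m \<Rightarrow> complex) \<Rightarrow> bool" where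
  "holo_fun M S f \<longleftrightarrow> openin (mtop M) S \<and>
     (\<forall>(W, \<phi>)\<in>atlas M. holo_on (cdim M) (\<phi> ` (S \<inter> W)) (\<lambda>z. f (inv_into W \<phi> z)))"

definition smooth_near :: "('m, 'z) cmanifold_scheme \<Rightarrow> 'm \<Rightarrow> ('m \<Rightarrow> complex) \<Rightarrow> bool" where
  "smooth_near M x f \<longleftrightarrow> (\<exists>S. x \<in> S \<and> smooth_fun M S f)"

definition holo_near :: "('m, 'z) cmanifold_scheme \<Rightarrow> 'm \<Rightarrow> ('m \<Rightarrow> complex) \<Rightarrow> bool" where
  "holo_near M x f \<longleftrightarrow> (\<exists>S. x \<in> S \<and> holo_fun M S f)"

section \<open>Complexified tangent vectors and vector fields\<close>

text \<open>
  A complexified tangent vector at \<open>x\<close> is a \<open>\<complex>\<close>-linear derivation at \<open>x\<close> on germs of smooth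
  complex-valued functions. The first clause fixes the value on functions that are not smooth near
  \<open>x\<close>, so that a tangent vector is determined by its action on germs.
\<close>

type_synonym 'm tvec = "('m \<Rightarrow> complex) \<Rightarrow> complex"
type_synonym 'm vfield = "'m \<Rightarrow> 'm tvec"

definition tangent :: "('m, 'z) cmanifold_scheme \<Rightarrow> 'm \<Rightarrow> 'm tvec set" where
  "tangent M x = {v.
     (\<forall>f. \<not> smooth_near M x f \<longrightarrow> v f = 0) \<and>
     (\<forall>S f f'. x \<in> S \<longrightarrow> openin (mtop M) S \<longrightarrow> (\<forall>y\<in>S. f y = f' y) \<longrightarrow> v f = v f') \<and>
     (\<forall>f f'. smooth_near M x f \<longrightarrow> smooth_near M x f' \<longrightarrow>
        v (\<lambda>y. f y + f' y) = v f + v f' \<and>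
        v (\<lambda>y. f y * f' y) = v f * f' x + f x * v f') \<and>
     (\<forall>c f. smooth_near M x f \<longrightarrow> v (\<lambda>y. c * f y) = c * v f)}"

text \<open>A vector has type \<open>(1,0)\<close> if it annihilates the antiholomorphic functions.\<close>

definition tangent10 :: "('m, 'z) cmanifold_scheme \<Rightarrow> 'm \<Rightarrow> 'm tvec set" where
  "tangent10 M x = {v \<in> tangent M x. \<forall>f. holo_near M x f \<longrightarrow> v (\<lambda>y. cnj (f y)) = 0}"

definition cnj_vec :: "'m tvec \<Rightarrow> 'm tvec" where
  "cnj_vec v = (\<lambda>f. cnj (v (\<lambda>y. cnj (f y))))"

definition cnj_field :: "'m vfield \<Rightarrow> 'm vfield" where
  "cnj_field X = (\<lambda>x. cnj_vec (X x))"

definition smooth_vfield :: "('m, 'z) cmanifold_scheme \<Rightarrow> 'm set \<Rightarrow> 'm vfield \<Rightarrow> bool" where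
  "smooth_vfield M S X \<longleftrightarrow> openin (mtop M) S \<and> (\<forall>x\<in>S. X x \<in> tangent M x) \<and>
     (\<forall>T f. T \<subseteq> S \<longrightarrow> smooth_fun M T f \<longrightarrow> smooth_fun M T (\<lambda>x. X x f))"

definition vfield10 :: "('m, 'z) cmanifold_scheme \<Rightarrow> 'm set \<Rightarrow> 'm vfield \<Rightarrow> bool" where
  "vfield10 M S X \<longleftrightarrow> smooth_vfield M S X \<and> (\<forall>x\<in>S. X x \<in> tangent10 M x)"

definition holo_vfield :: "('m, 'z) cmanifold_scheme \<Rightarrow> 'm set \<Rightarrow> 'm vfield \<Rightarrow> bool" where
  "holo_vfield M S X \<longleftrightarrow> vfield10 M S X \<and>
     (\<forall>T f. T \<subseteq> S \<longrightarrow> holo_fun M T f \<longrightarrow> holo_fun M T (\<lambda>x. X x f))"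

definition lie_bracket :: "('m, 'z) cmanifold_scheme \<Rightarrow> 'm vfield \<Rightarrow> 'm vfield \<Rightarrow> 'm vfield" where
  "lie_bracket M X Y = (\<lambda>x f.
     if smooth_near M x f then X x (\<lambda>y. Y y f) - Y x (\<lambda>y. X y f) else 0)"

section \<open>Holomorphic vector bundles\<close>

text \<open>
  The fibres are subspaces \<open>fibre K x\<close> of one complex vector space \<open>('v, scal K)\<close>. This ambient
  space may have any dimension and carries no topology; it only serves to have all fibres inside one
  type (any family of vector spaces embeds into its direct sum). Fibres over different points may
  overlap, so the total space is \<open>Sigma (topspace (mtop K)) (fibre K)\<close>. The holomorphic structure
  is given by local frames \<open>(W, e)\<close> with holomorphic transition matrices.
\<close>

record ('m, 'v) hbundle = "'m cmanifold" +
  scal :: "complex \<Rightarrow> 'v \<Rightarrow> 'v"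
  rank :: nat
  fibre :: "'m \<Rightarrow> 'v set"
  frames :: "('m set \<times> (nat \<Rightarrow> 'm \<Rightarrow> 'v)) set"

definition coord ::
  "('m, 'v::ab_group_add) hbundle \<Rightarrow> (nat \<Rightarrow> 'm \<Rightarrow> 'v) \<Rightarrow> nat \<Rightarrow> 'm \<Rightarrow> 'v \<Rightarrow> complex" where
  "coord K e j x a = module.representation (scal K) ((\<lambda>i. e i x) ` {..<rank K}) a (e j x)"

definition holomorphic_vector_bundle :: "('m, 'v::ab_group_add) hbundle \<Rightarrow> bool" where
  "holomorphic_vector_bundle K \<longleftrightarrow>
     complex_manifold K \<and>
     vector_space (scal K) \<and>
     (\<Union>(W, e)\<in>frames K. W) = topspace (mtop K) \<and>
     (\<forall>(W, e)\<in>frames K. openin (mtop K) W \<and>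
        (\<forall>x\<in>W. inj_on (\<lambda>j. e j x) {..<rank K} \<and>
           \<not> module.dependent (scal K) ((\<lambda>j. e j x) ` {..<rank K}) \<and>
           module.span (scal K) ((\<lambda>j. e j x) ` {..<rank K}) = fibre K x)) \<and>
     (\<forall>(W, e)\<in>frames K. \<forall>(W', e')\<in>frames K. \<forall>i<rank K. \<forall>j<rank K.
        holo_fun K (W \<inter> W') (\<lambda>x. coord K e i x (e' j x)))"

abbreviation base :: "('m, 'v::ab_group_add) hbundle \<Rightarrow> 'm set" where
  "base K \<equiv> topspace (mtop K)"

text \<open>Sections are taken over arbitrary open sets \<open>S\<close>; values outside \<open>S\<close> are irrelevant.\<close>

definition smooth_section ::
  "('m, 'v::ab_group_add) hbundle \<Rightarrow> 'm set \<Rightarrow> ('m \<Rightarrow> 'v) \<Rightarrow> bool" where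
  "smooth_section K S s \<longleftrightarrow> openin (mtop K) S \<and> (\<forall>x\<in>S. s x \<in> fibre K x) \<and>
     (\<forall>(W, e)\<in>frames K. \<forall>j<rank K. smooth_fun K (S \<inter> W) (\<lambda>x. coord K e j x (s x)))"

definition holo_section ::
  "('m, 'v::ab_group_add) hbundle \<Rightarrow> 'm set \<Rightarrow> ('m \<Rightarrow> 'v) \<Rightarrow> bool" where
  "holo_section K S s \<longleftrightarrow> openin (mtop K) S \<and> (\<forall>x\<in>S. s x \<in> fibre K x) \<and>
     (\<forall>(W, e)\<in>frames K. \<forall>j<rank K. holo_fun K (S \<inter> W) (\<lambda>x. coord K e j x (s x)))"

definition section_near ::
  "('m, 'v::ab_group_add) hbundle \<Rightarrow> 'm \<Rightarrow> ('m \<Rightarrow> 'v) \<Rightarrow> bool" where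
  "section_near K x s \<longleftrightarrow> (\<exists>S. x \<in> S \<and> smooth_section K S s)"

section \<open>Endomorphisms, one-forms and bilinear forms\<close>

type_synonym ('m, 'v) endo = "'m \<Rightarrow> 'v \<Rightarrow> 'v"
type_synonym ('m, 'v) form = "'m \<Rightarrow> 'm tvec \<Rightarrow> 'v \<Rightarrow> 'v"

definition fibre_linear ::
  "('m, 'v::ab_group_add) hbundle \<Rightarrow> 'm \<Rightarrow> ('v \<Rightarrow> 'v) \<Rightarrow> bool" where
  "fibre_linear K x L \<longleftrightarrow> (\<forall>a\<in>fibre K x. L a \<in> fibre K x \<and>
     (\<forall>b\<in>fibre K x. L (a + b) = L a + L b) \<and> (\<forall>c. L (scal K c a) = scal K c (L a)))"

definition fibre_antilinear ::
  "('m, 'v::ab_group_add) hbundle \<Rightarrow> 'm \<Rightarrow> ('v \<Rightarrow> 'v) \<Rightarrow> bool" where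
  "fibre_antilinear K x L \<longleftrightarrow> (\<forall>a\<in>fibre K x. L a \<in> fibre K x \<and>
     (\<forall>b\<in>fibre K x. L (a + b) = L a + L b) \<and> (\<forall>c. L (scal K c a) = scal K (cnj c) (L a)))"

text \<open>
  Smoothness and holomorphy of bundle maps and forms is expressed on local sections: an
  \<open>\<O>\<close>- or \<open>C\<^sup>\<infinity>\<close>-matrix in frames is one that preserves the respective local sections.
\<close>

definition smooth_map ::
  "('m, 'v::ab_group_add) hbundle \<Rightarrow> ('m, 'v) endo \<Rightarrow> bool" where
  "smooth_map K T \<longleftrightarrow>
     (\<forall>S s. smooth_section K S s \<longrightarrow> smooth_section K S (\<lambda>x. T x (s x)))"

definition smooth_endo :: "('m, 'v::ab_group_add) hbundle \<Rightarrow> ('m, 'v) endo \<Rightarrow> bool" where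
  "smooth_endo K T \<longleftrightarrow> (\<forall>x\<in>base K. fibre_linear K x (T x)) \<and> smooth_map K T"

definition holo_endo :: "('m, 'v::ab_group_add) hbundle \<Rightarrow> ('m, 'v) endo \<Rightarrow> bool" where
  "holo_endo K T \<longleftrightarrow> (\<forall>x\<in>base K. fibre_linear K x (T x)) \<and>
     (\<forall>S s. holo_section K S s \<longrightarrow> holo_section K S (\<lambda>x. T x (s x)))"

definition along :: "('m, 'v) form \<Rightarrow> 'm vfield \<Rightarrow> ('m, 'v) endo" where
  "along C X = (\<lambda>x. C x (X x))"

text \<open>Elements of \<open>\<Omega>\<^sup>1 \<otimes> \<O>(End K)\<close>; only the values on \<open>(1,0)\<close>-vectors matter.\<close>

definition holo_endo_form :: "('m, 'v::ab_group_add) hbundle \<Rightarrow> ('m, 'v) form \<Rightarrow> bool" where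
  "holo_endo_form K C \<longleftrightarrow>
     (\<forall>x\<in>base K. \<forall>v\<in>tangent10 K x. fibre_linear K x (C x v) \<and>
        (\<forall>a\<in>fibre K x.
           (\<forall>u\<in>tangent10 K x. C x (\<lambda>f. v f + u f) a = C x v a + C x u a) \<and>
           (\<forall>c. C x (\<lambda>f. c * v f) a = scal K c (C x v a)))) \<and>
     (\<forall>S X s. holo_vfield K S X \<longrightarrow> holo_section K S s \<longrightarrow>
        holo_section K S (\<lambda>x. along C X x (s x)))"

definition holo_symmetric_form ::
  "('m, 'v::ab_group_add) hbundle \<Rightarrow> ('m \<Rightarrow> 'v \<Rightarrow> 'v \<Rightarrow> complex) \<Rightarrow> bool" where
  "holo_symmetric_form K g \<longleftrightarrow>
     (\<forall>x\<in>base K. \<forall>a\<in>fibre K x. \<forall>b\<in>fibre K x. g x a b = g x b a \<and>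
        (\<forall>a'\<in>fibre K x. g x (a + a') b = g x a b + g x a' b) \<and>
        (\<forall>c. g x (scal K c a) b = c * g x a b)) \<and>
     (\<forall>x\<in>base K. \<forall>a\<in>fibre K x. (\<forall>b\<in>fibre K x. g x a b = 0) \<longrightarrow> a = 0) \<and>
     (\<forall>S s t. holo_section K S s \<longrightarrow> holo_section K S t \<longrightarrow>
        holo_fun K S (\<lambda>x. g x (s x) (t x)))"

definition endo_comm :: "('m, 'v::ab_group_add) endo \<Rightarrow> ('m, 'v) endo \<Rightarrow> ('m, 'v) endo" where
  "endo_comm T T' = (\<lambda>x a. T x (T' x a) - T' x (T x a))"

definition conjugate :: "('m, 'v) endo \<Rightarrow> ('m, 'v) endo \<Rightarrow> ('m, 'v) endo" where
  "conjugate \<kappa> T = (\<lambda>x a. \<kappa> x (T x (\<kappa> x a)))"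

definition herm :: "('m \<Rightarrow> 'v \<Rightarrow> 'v \<Rightarrow> complex) \<Rightarrow> ('m, 'v) endo \<Rightarrow> 'm \<Rightarrow> 'v \<Rightarrow> 'v \<Rightarrow> complex" where
  "herm g \<kappa> = (\<lambda>x a b. g x a (\<kappa> x b))"

definition hermitian_form ::
  "('m, 'v::ab_group_add) hbundle \<Rightarrow> ('m \<Rightarrow> 'v \<Rightarrow> 'v \<Rightarrow> complex) \<Rightarrow> bool" where
  "hermitian_form K h \<longleftrightarrow>
     (\<forall>x\<in>base K. \<forall>a\<in>fibre K x. \<forall>b\<in>fibre K x. h x b a = cnj (h x a b) \<and>
        (\<forall>a'\<in>fibre K x. h x (a + a') b = h x a b + h x a' b) \<and>
        (\<forall>c. h x (scal K c a) b = c * h x a b)) \<and>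
     (\<forall>x\<in>base K. \<forall>a\<in>fibre K x. (\<forall>b\<in>fibre K x. h x a b = 0) \<longrightarrow> a = 0)"

definition adjoint_wrt ::
  "('m, 'v::ab_group_add) hbundle \<Rightarrow> ('m \<Rightarrow> 'v \<Rightarrow> 'v \<Rightarrow> complex) \<Rightarrow> ('m, 'v) endo \<Rightarrow> ('m, 'v) endo" where
  "adjoint_wrt K h T = (\<lambda>x b. THE c. c \<in> fibre K x \<and> (\<forall>a\<in>fibre K x. h x (T x a) b = h x a c))"

section \<open>Connections\<close>

text \<open>
  \<open>D x v s\<close> is the covariant derivative at \<open>x\<close>, in direction of the complexified tangent vector
  \<open>v\<close>, of a section \<open>s\<close> defined and smooth near \<open>x\<close>.
\<close>

type_synonym ('m, 'v) conn = "'m \<Rightarrow> 'm tvec \<Rightarrow> ('m \<Rightarrow> 'v) \<Rightarrow> 'v"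

definition smooth_connection :: "('m, 'v::ab_group_add) hbundle \<Rightarrow> ('m, 'v) conn \<Rightarrow> bool" where
  "smooth_connection K D \<longleftrightarrow>
     (\<forall>x\<in>base K. \<forall>v\<in>tangent K x. \<forall>s. section_near K x s \<longrightarrow>
        D x v s \<in> fibre K x \<and>
        (\<forall>S t. x \<in> S \<longrightarrow> openin (mtop K) S \<longrightarrow> (\<forall>y\<in>S. s y = t y) \<longrightarrow> D x v s = D x v t) \<and>
        (\<forall>u\<in>tangent K x. D x (\<lambda>f. v f + u f) s = D x v s + D x u s) \<and>
        (\<forall>c. D x (\<lambda>f. c * v f) s = scal K c (D x v s)) \<and>
        (\<forall>t. section_near K x t \<longrightarrow> D x v (\<lambda>y. s y + t y) = D x v s + D x v t) \<and>
        (\<forall>f. smooth_near K x f \<longrightarrow>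
           D x v (\<lambda>y. scal K (f y) (s y)) = scal K (v f) (s x) + scal K (f x) (D x v s))) \<and>
     (\<forall>S X s. smooth_vfield K S X \<longrightarrow> smooth_section K S s \<longrightarrow>
        smooth_section K S (\<lambda>x. D x (X x) s))"

definition deriv_along :: "('m, 'v) conn \<Rightarrow> 'm vfield \<Rightarrow> ('m \<Rightarrow> 'v) \<Rightarrow> 'm \<Rightarrow> 'v" where
  "deriv_along D X s = (\<lambda>x. D x (X x) s)"

text \<open>The induced derivative of an endomorphism, applied to a section.\<close>

definition deriv_endo ::
  "('m, 'v::ab_group_add) conn \<Rightarrow> 'm vfield \<Rightarrow> ('m, 'v) endo \<Rightarrow> ('m \<Rightarrow> 'v) \<Rightarrow> 'm \<Rightarrow> 'v" where
  "deriv_endo D X T s =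
     (\<lambda>x. deriv_along D X (\<lambda>y. T y (s y)) x - T x (deriv_along D X s x))"

definition curvature ::
  "('m, 'v::ab_group_add) hbundle \<Rightarrow> ('m, 'v) conn \<Rightarrow> 'm vfield \<Rightarrow> 'm vfield \<Rightarrow> ('m \<Rightarrow> 'v) \<Rightarrow> 'm \<Rightarrow> 'v" where
  "curvature K D X Y s =
     (\<lambda>x. deriv_along D X (deriv_along D Y s) x - deriv_along D Y (deriv_along D X s) x
          - deriv_along D (lie_bracket K X Y) s x)"

text \<open>
  For \<open>v\<close> of type \<open>(0,1)\<close>: write \<open>s\<close> in a holomorphic frame near \<open>x\<close> and differentiate the
  coefficients. The result does not depend on the frame chosen.
\<close>

definition dbar :: "('m, 'v::ab_group_add) hbundle \<Rightarrow> ('m, 'v) conn" where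
  "dbar K = (\<lambda>x v s.
     let e = snd (SOME F. F \<in> frames K \<and> x \<in> fst F)
     in \<Sum>j<rank K. scal K (v (\<lambda>y. coord K e j y (s y))) (e j x))"

definition extends_dbar :: "('m, 'v::ab_group_add) hbundle \<Rightarrow> ('m, 'v) conn \<Rightarrow> bool" where
  "extends_dbar K D \<longleftrightarrow> (\<forall>x\<in>base K. \<forall>v\<in>tangent10 K x. \<forall>s. section_near K x s \<longrightarrow>
     D x (cnj_vec v) s = dbar K x (cnj_vec v) s)"

definition chern_connection ::
  "('m, 'v::ab_group_add) hbundle \<Rightarrow> ('m \<Rightarrow> 'v \<Rightarrow> 'v \<Rightarrow> complex) \<Rightarrow> ('m, 'v) conn \<Rightarrow> bool" where
  "chern_connection K h D \<longleftrightarrow> smooth_connection K D \<and> extends_dbar K D \<and>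
     (\<forall>S X a b. smooth_vfield K S X \<longrightarrow> smooth_section K S a \<longrightarrow> smooth_section K S b \<longrightarrow>
        (\<forall>x\<in>S. X x (\<lambda>y. h y (a y) (b y)) =
           h x (deriv_along D X a x) (b x) + h x (a x) (deriv_along D (cnj_field X) b x)))"

definition flat_holo_connection :: "('m, 'v::ab_group_add) hbundle \<Rightarrow> ('m, 'v) conn \<Rightarrow> bool" where
  "flat_holo_connection K D \<longleftrightarrow> smooth_connection K D \<and> extends_dbar K D \<and>
     (\<forall>S X s. holo_vfield K S X \<longrightarrow> holo_section K S s \<longrightarrow> holo_section K S (deriv_along D X s)) \<and>
     (\<forall>S X Y s. smooth_vfield K S X \<longrightarrow> smooth_vfield K S Y \<longrightarrow> smooth_section K S s \<longrightarrow>
        (\<forall>x\<in>S. curvature K D X Y s x = 0))"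

section \<open>CV-structures and Saito structures\<close>

definition common_data ::
  "('m, 'v::ab_group_add) hbundle \<Rightarrow> ('m, 'v) form \<Rightarrow> ('m, 'v) endo \<Rightarrow>
   ('m \<Rightarrow> 'v \<Rightarrow> 'v \<Rightarrow> complex) \<Rightarrow> bool" where
  "common_data K C \<U> g \<longleftrightarrow>
     holomorphic_vector_bundle K \<and> holo_endo_form K C \<and> holo_endo K \<U> \<and> holo_symmetric_form K g \<and>
     (\<forall>S X Y. holo_vfield K S X \<longrightarrow> holo_vfield K S Y \<longrightarrow> (\<forall>x\<in>S. \<forall>a\<in>fibre K x.
        along C X x (along C Y x a) = along C Y x (along C X x a))) \<and>
     (\<forall>S X. holo_vfield K S X \<longrightarrow> (\<forall>x\<in>S. \<forall>a\<in>fibre K x.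
        endo_comm (along C X) \<U> x a = 0 \<and>
        (\<forall>b\<in>fibre K x. g x (along C X x a) b = g x a (along C X x b)))) \<and>
     (\<forall>x\<in>base K. \<forall>a\<in>fibre K x. \<forall>b\<in>fibre K x. g x (\<U> x a) b = g x a (\<U> x b))"

text \<open>
  The bracket of two \<open>(1,0)\<close>-fields is again of type \<open>(1,0)\<close>, so the last term only uses values of
  \<open>C\<close> on \<open>(1,0)\<close>-vectors.
\<close>

definition torsion_free ::
  "('m, 'v::ab_group_add) hbundle \<Rightarrow> ('m, 'v) form \<Rightarrow> ('m, 'v) conn \<Rightarrow> bool" where
  "torsion_free K C D \<longleftrightarrow>
     (\<forall>S X Y s. vfield10 K S X \<longrightarrow> vfield10 K S Y \<longrightarrow> smooth_section K S s \<longrightarrow>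
        (\<forall>x\<in>S. deriv_endo D X (along C Y) s x - deriv_endo D Y (along C X) s x
                - along C (lie_bracket K X Y) x (s x) = 0))"

text \<open>The hermitian form \<open>h\<close> of a CV-structure is determined by \<open>g\<close> and \<open>\<kappa>\<close> as \<open>herm g \<kappa>\<close>.\<close>

definition cv_structure ::
  "('m, 'v::ab_group_add) hbundle \<Rightarrow> ('m, 'v) form \<Rightarrow> ('m, 'v) endo \<Rightarrow>
   ('m \<Rightarrow> 'v \<Rightarrow> 'v \<Rightarrow> complex) \<Rightarrow> ('m, 'v) endo \<Rightarrow> ('m, 'v) conn \<Rightarrow> ('m, 'v) endo \<Rightarrow> bool" where
  "cv_structure K C \<U> g \<kappa> D \<Q> \<longleftrightarrow>
     common_data K C \<U> g \<and>
     smooth_map K \<kappa> \<and>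
     (\<forall>x\<in>base K. fibre_antilinear K x (\<kappa> x) \<and>
        (\<forall>a\<in>fibre K x. \<kappa> x (\<kappa> x a) = a \<and>
           (\<forall>b\<in>fibre K x. g x (\<kappa> x a) (\<kappa> x b) = cnj (g x a b)))) \<and>
     hermitian_form K (herm g \<kappa>) \<and>
     chern_connection K (herm g \<kappa>) D \<and>
     (\<forall>S X s. smooth_vfield K S X \<longrightarrow> smooth_section K S s \<longrightarrow>
        (\<forall>x\<in>S. deriv_along D X (\<lambda>y. \<kappa> y (s y)) x = \<kappa> x (deriv_along D (cnj_field X) s x))) \<and>
     torsion_free K C D \<and>
     (\<forall>S X Y s. vfield10 K S X \<longrightarrow> vfield10 K S Y \<longrightarrow> smooth_section K S s \<longrightarrow>
        (\<forall>x\<in>S. curvature K D X (cnj_field Y) s x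
                + endo_comm (along C X) (conjugate \<kappa> (along C Y)) x (s x) = 0)) \<and>
     smooth_endo K \<Q> \<and>
     (\<forall>x\<in>base K. \<forall>a\<in>fibre K x. \<forall>b\<in>fibre K x.
        g x (\<Q> x a) b = - g x a (\<Q> x b) \<and>
        herm g \<kappa> x (\<Q> x a) b = herm g \<kappa> x a (\<Q> x b)) \<and>
     (\<forall>S X s. vfield10 K S X \<longrightarrow> smooth_section K S s \<longrightarrow> (\<forall>x\<in>S.
        deriv_endo D X \<U> s x - endo_comm (along C X) \<Q> x (s x) + along C X x (s x) = 0 \<and>
        deriv_endo D X \<Q> s x + endo_comm (along C X) (conjugate \<kappa> \<U>) x (s x) = 0))"

definition saito_structure ::
  "('m, 'v::ab_group_add) hbundle \<Rightarrow> ('m, 'v) form \<Rightarrow> ('m, 'v) endo \<Rightarrow>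
   ('m \<Rightarrow> 'v \<Rightarrow> 'v \<Rightarrow> complex) \<Rightarrow> ('m, 'v) conn \<Rightarrow> ('m, 'v) endo \<Rightarrow> bool" where
  "saito_structure K C \<U> g N \<V> \<longleftrightarrow>
     common_data K C \<U> g \<and>
     flat_holo_connection K N \<and>
     holo_endo K \<V> \<and>
     (\<forall>S X s. smooth_vfield K S X \<longrightarrow> smooth_section K S s \<longrightarrow>
        (\<forall>x\<in>S. deriv_endo N X \<V> s x = 0)) \<and>
     torsion_free K C N \<and>
     (\<forall>S X s. vfield10 K S X \<longrightarrow> smooth_section K S s \<longrightarrow> (\<forall>x\<in>S.
        deriv_endo N X \<U> s x - endo_comm (along C X) \<V> x (s x) + along C X x (s x) = 0)) \<and>
     (\<forall>S X a b. smooth_vfield K S X \<longrightarrow> smooth_section K S a \<longrightarrow> smooth_section K S b \<longrightarrow>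
        (\<forall>x\<in>S. X x (\<lambda>y. g y (a y) (b y)) =
           g x (deriv_along N X a x) (b x) + g x (a x) (deriv_along N X b x))) \<and>
     (\<forall>x\<in>base K. \<forall>a\<in>fibre K x. \<forall>b\<in>fibre K x. g x (\<V> x a) b + g x a (\<V> x b) = 0)"

section \<open>Harmonic potential real Saito structures\<close>

text \<open>
  \<open>N\<close> is the flat connection of the Saito structure and \<open>Ab\<close> the \<open>h\<close>-adjoint of \<open>A\<close>. The equation
  \<open>D = N - [Ab, C]\<close> is split into its values on \<open>(1,0)\<close>- and on \<open>(0,1)\<close>-fields; on the latter the
  \<open>(1,0)\<close>-form \<open>C\<close> vanishes.
\<close>

definition harmonic_potential_real_saito ::
  "('m, 'v::ab_group_add) hbundle \<Rightarrow> ('m, 'v) form \<Rightarrow> ('m, 'v) endo \<Rightarrow>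
   ('m \<Rightarrow> 'v \<Rightarrow> 'v \<Rightarrow> complex) \<Rightarrow> ('m, 'v) endo \<Rightarrow> ('m, 'v) conn \<Rightarrow> ('m, 'v) endo \<Rightarrow>
   ('m, 'v) conn \<Rightarrow> ('m, 'v) endo \<Rightarrow> bool" where
  "harmonic_potential_real_saito K C \<U> g \<kappa> D \<Q> N \<V> \<longleftrightarrow>
     (\<exists>A. smooth_endo K A \<and>
        (\<forall>x\<in>base K. \<forall>a\<in>fibre K x. \<forall>b\<in>fibre K x. g x (A x a) b = g x a (A x b)) \<and>
        (let Ab = adjoint_wrt K (herm g \<kappa>) A in
          (\<forall>S X s. vfield10 K S X \<longrightarrow> smooth_section K S s \<longrightarrow> (\<forall>x\<in>S.
             deriv_along D X s x = deriv_along N X s x - endo_comm Ab (along C X) x (s x) \<and>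
             deriv_along D (cnj_field X) s x = deriv_along N (cnj_field X) s x \<and>
             deriv_endo D (cnj_field X) Ab s x = conjugate \<kappa> (along C X) x (s x))) \<and>
          (\<forall>x\<in>base K. \<forall>a\<in>fibre K x. \<Q> x a = \<V> x a - endo_comm \<U> Ab x a)))"

section \<open>Laurent series of sections and the associated connections\<close>

text \<open>
  A Laurent series \<open>\<Sum>\<^sub>i z\<^sup>i s\<^sub>i\<close> of sections is given by its coefficients \<open>s i\<close>, which vanish for
  \<open>i\<close> small enough; below, only series of this kind occur.
\<close>

type_synonym ('m, 'v) laurent = "int \<Rightarrow> 'm \<Rightarrow> 'v"

definition laurent_const :: "('m \<Rightarrow> 'v::ab_group_add) \<Rightarrow> ('m, 'v) laurent" where
  "laurent_const a = (\<lambda>i. if i = 0 then a else (\<lambda>x. 0))"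

text \<open>
  Each definition gives the coefficient of \<open>z\<^sup>i\<close> after extension by the Leibniz rule. In direction
  of \<open>X\<close> the Saito and the CV connection are given by the same formula \<open>nabla_z\<close>, applied to
  different connections on \<open>K\<close>.
\<close>

definition nabla_z ::
  "('m, 'v::ab_group_add) form \<Rightarrow> ('m, 'v) conn \<Rightarrow> 'm vfield \<Rightarrow> ('m, 'v) laurent \<Rightarrow> ('m, 'v) laurent" where
  "nabla_z C D X s = (\<lambda>i x. deriv_along D X (s i) x + along C X x (s (i + 1) x))"

definition saito_nabla_bar ::
  "('m, 'v::ab_group_add) hbundle \<Rightarrow> 'm vfield \<Rightarrow> ('m, 'v) laurent \<Rightarrow> ('m, 'v) laurent" where
  "saito_nabla_bar K X s = (\<lambda>i x. deriv_along (dbar K) (cnj_field X) (s i) x)"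

definition saito_nabla_U ::
  "('m, 'v::ab_group_add) hbundle \<Rightarrow> ('m, 'v) endo \<Rightarrow> ('m, 'v) endo \<Rightarrow> int \<Rightarrow>
   ('m, 'v) laurent \<Rightarrow> ('m, 'v) laurent" where
  "saito_nabla_U K \<U> \<V> w s = (\<lambda>i x.
     scal K (of_int i) (s i x)
     + \<U> x (s (i + 1) x) - \<V> x (s i x) + scal K (of_int w / 2) (s i x))"

definition cv_nabla_bar ::
  "('m, 'v::ab_group_add) form \<Rightarrow> ('m, 'v) endo \<Rightarrow> ('m, 'v) conn \<Rightarrow> 'm vfield \<Rightarrow>
   ('m, 'v) laurent \<Rightarrow> ('m, 'v) laurent" where
  "cv_nabla_bar C \<kappa> D X s = (\<lambda>i x.
     deriv_along D (cnj_field X) (s i) x + conjugate \<kappa> (along C X) x (s (i - 1) x))"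

definition cv_nabla_U ::
  "('m, 'v::ab_group_add) hbundle \<Rightarrow> ('m, 'v) endo \<Rightarrow> ('m, 'v) endo \<Rightarrow> ('m, 'v) endo \<Rightarrow> int \<Rightarrow>
   ('m, 'v) laurent \<Rightarrow> ('m, 'v) laurent" where
  "cv_nabla_U K \<U> \<kappa> \<Q> w s = (\<lambda>i x.
     scal K (of_int i) (s i x)
     + \<U> x (s (i + 1) x) - \<Q> x (s i x) + scal K (of_int w / 2) (s i x)
     + conjugate \<kappa> \<U> x (s (i - 1) x))"

text \<open>
  \<open>pairing g w s t n x\<close> is the coefficient of \<open>z\<^sup>n\<close> in
  \<open>P(s, t) = z\<^sup>w \<Sum>\<^sub>i\<^sub>,\<^sub>j (-1)\<^sup>j z\<^sup>i\<^sup>+\<^sup>j g(s\<^sub>i, t\<^sub>j)\<close> at \<open>x\<close>; the index set is restricted to make the sum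
  finite.
\<close>

definition pairing ::
  "('m \<Rightarrow> 'v::ab_group_add \<Rightarrow> 'v \<Rightarrow> complex) \<Rightarrow> int \<Rightarrow> ('m, 'v) laurent \<Rightarrow> ('m, 'v) laurent \<Rightarrow>
   int \<Rightarrow> 'm \<Rightarrow> complex" where
  "pairing g w s t n x =
     (\<Sum>(i, j)\<in>{(i, j). i + j + w = n \<and> s i x \<noteq> 0 \<and> t j x \<noteq> 0}. (- 1) powi j * g x (s i x) (t j x))"

text \<open>The action of a formal power series \<open>\<Psi> = \<Sum>\<^sub>i z\<^sup>i \<Psi>\<^sub>i\<close> of endomorphisms on Laurent series.\<close>

definition series_apply ::
  "(nat \<Rightarrow> ('m, 'v::ab_group_add) endo) \<Rightarrow> ('m, 'v) laurent \<Rightarrow> ('m, 'v) laurent" where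
  "series_apply \<Psi> s = (\<lambda>n x. \<Sum>i\<in>{i. s (n - int i) x \<noteq> 0}. \<Psi> i x (s (n - int i) x))"

definition laurent_cong ::
  "int \<Rightarrow> 'm set \<Rightarrow> (int \<Rightarrow> 'm \<Rightarrow> 'b) \<Rightarrow> (int \<Rightarrow> 'm \<Rightarrow> 'b) \<Rightarrow> bool" where
  "laurent_cong k S s t \<longleftrightarrow> (\<forall>j<k. \<forall>x\<in>S. s j x = t j x)"

text \<open>
  \<open>A_condition \<dots> k\<close> is the \<open>A(k-1)\<close>-condition. In the third condition, the coefficient of \<open>z\<^sup>n\<close> in
  \<open>z\<^bsup>-w-1\<^esup> P\<close> is the coefficient of \<open>z\<^bsup>n+w+1\<^esup>\<close> in \<open>P\<close>.
\<close>

definition A_condition ::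
  "('m, 'v::ab_group_add) hbundle \<Rightarrow> ('m, 'v) form \<Rightarrow> ('m, 'v) endo \<Rightarrow>
   ('m \<Rightarrow> 'v \<Rightarrow> 'v \<Rightarrow> complex) \<Rightarrow> ('m, 'v) endo \<Rightarrow> ('m, 'v) conn \<Rightarrow> ('m, 'v) endo \<Rightarrow>
   ('m, 'v) conn \<Rightarrow> ('m, 'v) endo \<Rightarrow> int \<Rightarrow> nat \<Rightarrow> bool" where
  "A_condition K C \<U> g \<kappa> D \<Q> N \<V> w k \<longleftrightarrow>
     (\<exists>\<Psi>. (\<forall>i. smooth_endo K (\<Psi> i)) \<and> (\<forall>x\<in>base K. \<forall>a\<in>fibre K x. \<Psi> 0 x a = a) \<and>
        (\<forall>S X a. vfield10 K S X \<longrightarrow> smooth_section K S a \<longrightarrow>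
           laurent_cong (int k) S
             (nabla_z C D X (series_apply \<Psi> (laurent_const a)))
             (series_apply \<Psi> (nabla_z C N X (laurent_const a)))) \<and>
        (\<forall>S a. smooth_section K S a \<longrightarrow>
           laurent_cong (int k) S
             (cv_nabla_U K \<U> \<kappa> \<Q> w (series_apply \<Psi> (laurent_const a)))
             (series_apply \<Psi> (saito_nabla_U K \<U> \<V> w (laurent_const a)))) \<and>
        (\<forall>S a b. smooth_section K S a \<longrightarrow> smooth_section K S b \<longrightarrow>
           laurent_cong (int k) S
             (\<lambda>n. pairing g w (series_apply \<Psi> (laurent_const a)) (series_apply \<Psi> (laurent_const b))
                    (n + w + 1))
             (\<lambda>n. pairing g w (laurent_const a) (laurent_const b) (n + w + 1))) \<and>
        (\<forall>S X a. vfield10 K S X \<longrightarrow> smooth_section K S a \<longrightarrow>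
           laurent_cong (int k + 1) S
             (cv_nabla_bar C \<kappa> D X (series_apply \<Psi> (laurent_const a)))
             (series_apply \<Psi> (saito_nabla_bar K X (laurent_const a)))))"

end

theory Submission
  imports Defs
begin

text \<open>
  Comparing the coefficients of \<open>z\<^sup>0\<close> in the equations for \<open>\<nabla>\<^sub>X\<close> and \<open>\<nabla>\<^sub>U\<close>, of \<open>z\<^sup>1\<close> in the equation for
  \<open>\<nabla>\<close> in antiholomorphic directions, and of \<open>z\<^sup>0\<close> in the (shifted) pairing shows that the
  \<open>A(0)\<close>-condition only involves \<open>T = \<Psi>\<^sub>1\<close>; all coefficients below hold automatically. The resulting
  equations are those of a harmonic potential for \<open>A\<^sup>\<flat> = - T\<close>. For \<open>g\<close>-symmetric \<open>A\<close> the adjoint is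
  \<open>A\<^sup>\<flat> = \<kappa>A\<kappa>\<close>, so \<open>T \<mapsto> A = - \<kappa>T\<kappa>\<close> translates between smooth \<open>g\<close>-symmetric solutions.
\<close>

section \<open>Smooth functions\<close>

lemma Ck_on_SucD:
  assumes "Ck_on d (Suc k) V f" "i < d" "c \<in> {1, \<i>}"
  obtains f' where "Ck_on d k V f'"
    "\<And>z. z \<in> V \<Longrightarrow> ((\<lambda>t::real. f (z(i := z i + of_real t * c))) has_vector_derivative f' z) (at 0)"
  using assms unfolding Ck_on.simps by blast

text \<open>Real directional derivatives commute with a real-linear map, so the induction on the
  order passes through \<open>L\<close>. Asking only for real linearity lets the same lemma cover
  complex conjugation and multiplication by a constant.\<close>

lemma Ck_on_bounded_linear:
  assumes L: "bounded_linear L"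
  shows "Ck_on d k V f \<Longrightarrow> Ck_on d k V (\<lambda>z. L (f z))"
proof (induction k arbitrary: f)
  case 0
  then show ?case by (simp add: bounded_linear.continuous_on[OF L])
next
  case (Suc k)
  have "\<exists>f'. Ck_on d k V f' \<and> (\<forall>z\<in>V. ((\<lambda>t::real. L (f (z(i := z i + of_real t * c))))
          has_vector_derivative f' z) (at 0))"
    if ic: "i < d" "c \<in> {1, \<i>}" for i c
  proof -
    obtain f' where "Ck_on d k V f'"
      "\<And>z. z \<in> V \<Longrightarrow> ((\<lambda>t::real. f (z(i := z i + of_real t * c))) has_vector_derivative f' z) (at 0)"
      by (rule Ck_on_SucD[OF Suc.prems ic]) blast
    then show ?thesis
      using Suc.IH bounded_linear.has_vector_derivative[OF L] by blast
  qed
  then show ?case using Suc.prems bounded_linear.continuous_on[OF L] by auto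
qed

lemma Ck_on_add: "Ck_on d k V f \<Longrightarrow> Ck_on d k V f' \<Longrightarrow> Ck_on d k V (\<lambda>z. f z + f' z)"
proof (induction k arbitrary: f f')
  case 0
  then show ?case by (simp add: continuous_on_add)
next
  case (Suc k)
  have "\<exists>F. Ck_on d k V F \<and> (\<forall>z\<in>V. ((\<lambda>t::real. f (z(i := z i + of_real t * c))
          + f' (z(i := z i + of_real t * c))) has_vector_derivative F z) (at 0))"
    if ic: "i < d" "c \<in> {1, \<i>}" for i c
  proof -
    obtain F where F: "Ck_on d k V F"
      "\<And>z. z \<in> V \<Longrightarrow> ((\<lambda>t::real. f (z(i := z i + of_real t * c))) has_vector_derivative F z) (at 0)"
      by (rule Ck_on_SucD[OF Suc.prems(1) ic]) blast
    obtain F' where F': "Ck_on d k V F'"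
      "\<And>z. z \<in> V \<Longrightarrow> ((\<lambda>t::real. f' (z(i := z i + of_real t * c))) has_vector_derivative F' z) (at 0)"
      by (rule Ck_on_SucD[OF Suc.prems(2) ic]) blast
    show ?thesis
      by (rule exI[of _ "\<lambda>z. F z + F' z"])
        (use F F' Suc.IH[OF F(1) F'(1)] in \<open>simp add: has_vector_derivative_add\<close>)
  qed
  then show ?case using Suc.prems by (auto intro: continuous_on_add)
qed

lemma Ck_on_zero: "Ck_on d k V (\<lambda>z. 0)"
  by (induction k) (auto intro!: exI[of _ "\<lambda>z. 0"])

lemma smooth_fun_bounded_linear:
  "bounded_linear L \<Longrightarrow> smooth_fun M S f \<Longrightarrow> smooth_fun M S (\<lambda>x. L (f x))"
  unfolding smooth_fun_def Cinf_on_def by (auto intro!: Ck_on_bounded_linear[where L = L])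

lemma smooth_fun_add:
  "smooth_fun M S f \<Longrightarrow> smooth_fun M S f' \<Longrightarrow> smooth_fun M S (\<lambda>x. f x + f' x)"
  unfolding smooth_fun_def Cinf_on_def by (auto intro!: Ck_on_add)

lemma smooth_fun_sum:
  fixes n :: nat
  assumes "openin (mtop M) S" "\<And>j. j < n \<Longrightarrow> smooth_fun M S (f j)"
  shows "smooth_fun M S (\<lambda>x. \<Sum>j<n. f j x)"
  using assms(2)
proof (induction n)
  case 0
  then show ?case using assms(1) by (auto simp: smooth_fun_def Cinf_on_def Ck_on_zero)
next
  case (Suc n)
  then show ?case by (auto intro: smooth_fun_add)
qed

text \<open>Agreement on \<open>V\<close> does not settle the derivative clause at once, because the
  lines in \<open>Ck_on\<close> may leave \<open>V\<close>. Openness relative to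
  \<open>complex_space d\<close> keeps them in \<open>V\<close> for small parameters, which is all
  that a derivative at 0 sees.\<close>

lemma Ck_on_cong:
  assumes "openin (top_of_set (complex_space d)) V"
  shows "(\<And>z. z \<in> V \<Longrightarrow> f z = f' z) \<Longrightarrow> Ck_on d k V f \<Longrightarrow> Ck_on d k V f'"
proof (induction k arbitrary: f f')
  case 0
  then show ?case by (auto cong: continuous_on_cong)
next
  case (Suc k)
  obtain T where T: "open T" "V = complex_space d \<inter> T"
    using assms by (auto simp: openin_open)
  \<comment> \<open>Changing a coordinate \<open>i < d\<close> does not leave
    \<open>complex_space d\<close>, so only the ambient open set \<open>T\<close> has to be
    respected. The line is continuous into the product topology because each coordinate is.\<close>
  have ev: "\<forall>\<^sub>F t in at (0::real). z(i := z i + of_real t * c) \<in> V"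
    if "z \<in> V" "i < d" for z i and c :: complex
  proof -
    have "continuous_on UNIV (\<lambda>t::real. z(i := z i + of_real t * c))"
    proof (rule continuous_on_coordinatewise_then_product)
      show "continuous_on UNIV (\<lambda>t::real. (z(i := z i + of_real t * c)) j)" for j
        by (cases "j = i") (auto intro!: continuous_intros)
    qed
    then have "((\<lambda>t::real. z(i := z i + of_real t * c)) \<longlongrightarrow> z(i := z i + of_real 0 * c)) (at 0)"
      unfolding continuous_on_def by (rule bspec) simp
    then have "\<forall>\<^sub>F t in at (0::real). z(i := z i + of_real t * c) \<in> T"
      using T that by (intro topological_tendstoD) auto
    then show ?thesis
      by eventually_elim (use T that in \<open>auto simp: complex_space_def\<close>)
  qed
  have "\<exists>F. Ck_on d k V F \<and> (\<forall>z\<in>V. ((\<lambda>t::real. f' (z(i := z i + of_real t * c)))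
          has_vector_derivative F z) (at 0))"
    if ic: "i < d" "c \<in> {1, \<i>}" for i c
  proof -
    obtain F where F: "Ck_on d k V F"
      "\<And>z. z \<in> V \<Longrightarrow> ((\<lambda>t::real. f (z(i := z i + of_real t * c))) has_vector_derivative F z) (at 0)"
      by (rule Ck_on_SucD[OF Suc.prems(2) ic]) blast
    have "((\<lambda>t::real. f' (z(i := z i + of_real t * c))) has_vector_derivative F z) (at 0)"
      if "z \<in> V" for z
      unfolding has_vector_derivative_def
    proof (rule has_derivative_transform_eventually)
      show "((\<lambda>t::real. f (z(i := z i + of_real t * c))) has_derivative (\<lambda>x. x *\<^sub>R F z)) (at 0)"
        using F that by (simp add: has_vector_derivative_def)
      show "\<forall>\<^sub>F t in at 0. f (z(i := z i + complex_of_real t * c)) = f' (z(i := z i + complex_of_real t * c))"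
        using ev[OF that \<open>i < d\<close>] by eventually_elim (use Suc.prems in auto)
    qed (use that Suc.prems in auto)
    then show ?thesis using F by blast
  qed
  moreover have "continuous_on V f'"
    using Suc.prems by (auto cong: continuous_on_cong)
  ultimately show ?case by auto
qed

text \<open>A chart is open onto its image, and that image is open in the model space. This supplies
  the open domain that \<open>Ck_on_cong\<close> demands.\<close>

lemma openin_chart_image:
  assumes "complex_manifold M" "(W, \<phi>) \<in> atlas M" "openin (mtop M) S"
  shows "openin (top_of_set (complex_space (cdim M))) (\<phi> ` (S \<inter> W))"
proof -
  have *: "openin (top_of_set (complex_space (cdim M))) (\<phi> ` W)"
    "homeomorphic_map (subtopology (mtop M) W) (top_of_set (\<phi> ` W)) \<phi>"
    using assms unfolding complex_manifold_def by auto
  have "openin (subtopology (mtop M) W) (S \<inter> W)"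
    using assms(3) by (auto simp: openin_subtopology)
  then have "openin (top_of_set (\<phi> ` W)) (\<phi> ` (S \<inter> W))"
    using homeomorphic_imp_open_map[OF *(2)] by (simp add: open_map_def)
  then show ?thesis using *(1) openin_trans by blast
qed

lemma smooth_fun_cong:
  assumes "complex_manifold M" "\<And>x. x \<in> S \<Longrightarrow> f x = f' x" "smooth_fun M S f"
  shows "smooth_fun M S f'"
proof -
  have "Ck_on (cdim M) k (\<phi> ` (S \<inter> W)) (\<lambda>z. f' (inv_into W \<phi> z))"
    if W: "(W, \<phi>) \<in> atlas M" for W \<phi> k
  proof (rule Ck_on_cong)
    show "openin (top_of_set (complex_space (cdim M))) (\<phi> ` (S \<inter> W))"
      using openin_chart_image[OF assms(1) W] assms(3) by (auto simp: smooth_fun_def)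
    show "Ck_on (cdim M) k (\<phi> ` (S \<inter> W)) (\<lambda>z. f (inv_into W \<phi> z))"
      using assms(3) W by (auto simp: smooth_fun_def Cinf_on_def)
    have "openin (mtop M) W"
      "homeomorphic_map (subtopology (mtop M) W) (top_of_set (\<phi> ` W)) \<phi>"
      using assms(1) W unfolding complex_manifold_def by auto
    \<comment> \<open>Injectivity ensures that \<open>inv_into W \<phi> z\<close> lies in
      \<open>S \<inter> W\<close> for every \<open>z\<close> in the image of this set; there the two
      functions agree.\<close>
    then have "inj_on \<phi> W"
      using homeomorphic_imp_injective_map openin_subset
      by (metis inf.absorb2 topspace_subtopology)
    then show "f (inv_into W \<phi> z) = f' (inv_into W \<phi> z)" if "z \<in> \<phi> ` (S \<inter> W)" for z
      using that assms(2) by auto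
  qed
  then show ?thesis using assms(3) by (auto simp: smooth_fun_def Cinf_on_def)
qed

section \<open>Complex conjugation of functions and tangent vectors\<close>

lemma smooth_near_cnj: "smooth_near M x f \<Longrightarrow> smooth_near M x (\<lambda>y. cnj (f y))"
  unfolding smooth_near_def using smooth_fun_bounded_linear[OF bounded_linear_cnj, of M _ f] by blast

lemma smooth_near_cnj_iff: "smooth_near M x (\<lambda>y. cnj (f y)) \<longleftrightarrow> smooth_near M x f"
  using smooth_near_cnj[of M x f] smooth_near_cnj[of M x "\<lambda>y. cnj (f y)"] by auto

text \<open>The two conjugations in \<open>cnj_vec\<close> cancel each other's antilinearity, so
  every clause of \<open>tangent\<close> is inherited. Connections may therefore be evaluated in
  (0,1)-directions.\<close>

lemma cnj_vec_tangent:
  assumes "v \<in> tangent M x"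
  shows "cnj_vec v \<in> tangent M x"
proof -
  have 1: "\<And>f. \<not> smooth_near M x f \<Longrightarrow> v f = 0"
    and 2: "\<And>S f f'. x \<in> S \<Longrightarrow> openin (mtop M) S \<Longrightarrow> (\<forall>y\<in>S. f y = f' y) \<Longrightarrow> v f = v f'"
    and 3: "\<And>f f'. smooth_near M x f \<Longrightarrow> smooth_near M x f' \<Longrightarrow> v (\<lambda>y. f y + f' y) = v f + v f'"
    and 4: "\<And>f f'. smooth_near M x f \<Longrightarrow> smooth_near M x f' \<Longrightarrow>
      v (\<lambda>y. f y * f' y) = v f * f' x + f x * v f'"
    and 5: "\<And>c f. smooth_near M x f \<Longrightarrow> v (\<lambda>y. c * f y) = c * v f"
    using assms unfolding tangent_def by simp_all
  show ?thesis
    unfolding tangent_def cnj_vec_def mem_Collect_eq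
  proof (intro conjI allI impI)
    show "cnj (v (\<lambda>y. cnj (f y))) = cnj (v (\<lambda>y. cnj (f' y)))"
      if "x \<in> S" "openin (mtop M) S" "\<forall>y\<in>S. f y = f' y" for S f f'
      using 2[of S "\<lambda>y. cnj (f y)" "\<lambda>y. cnj (f' y)"] that by simp
  qed (simp_all add: 1 3 4 5 smooth_near_cnj_iff)
qed

section \<open>Sections and connections\<close>

locale holo_bundle =
  fixes K :: "('m, 'v::ab_group_add) hbundle"
  assumes holomorphic: "holomorphic_vector_bundle K"
begin

sublocale scal: vector_space "scal K"
  using holomorphic by (simp add: holomorphic_vector_bundle_def)

lemma manifold: "complex_manifold K"
  using holomorphic by (simp add: holomorphic_vector_bundle_def)

lemma frame_at:
  assumes "x \<in> base K"
  obtains W e where "(W, e) \<in> frames K" "x \<in> W"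
  using assms holomorphic unfolding holomorphic_vector_bundle_def by blast

lemma
  assumes "(W, e) \<in> frames K"
  shows openin_frame: "openin (mtop K) W"
    and inj_frame: "x \<in> W \<Longrightarrow> inj_on (\<lambda>j. e j x) {..<rank K}"
    and independent_frame: "x \<in> W \<Longrightarrow> scal.independent ((\<lambda>j. e j x) ` {..<rank K})"
    and span_frame: "x \<in> W \<Longrightarrow> scal.span ((\<lambda>j. e j x) ` {..<rank K}) = fibre K x"
  using assms holomorphic unfolding holomorphic_vector_bundle_def by blast+

lemma smooth_fun_transition:
  assumes "(W, e) \<in> frames K" "(W', e') \<in> frames K" "i < rank K" "j < rank K"
  shows "smooth_fun K (W \<inter> W') (\<lambda>x. coord K e i x (e' j x))"
proof -
  have "\<forall>(W, e)\<in>frames K. \<forall>(W', e')\<in>frames K. \<forall>i<rank K. \<forall>j<rank K.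
      holo_fun K (W \<inter> W') (\<lambda>x. coord K e i x (e' j x))"
    using holomorphic unfolding holomorphic_vector_bundle_def by (elim conjE)
  then have "holo_fun K (W \<inter> W') (\<lambda>x. coord K e i x (e' j x))"
    using assms by fast
  then show ?thesis by (auto simp: holo_fun_def smooth_fun_def holo_on_def)
qed

lemma subspace_fibre: "x \<in> base K \<Longrightarrow> scal.subspace (fibre K x)"
  by (metis frame_at span_frame scal.subspace_span)

lemma
  assumes "x \<in> base K"
  shows fibre_zero [simp]: "0 \<in> fibre K x"
    and fibre_add: "a \<in> fibre K x \<Longrightarrow> b \<in> fibre K x \<Longrightarrow> a + b \<in> fibre K x"
    and fibre_scale: "a \<in> fibre K x \<Longrightarrow> scal K c a \<in> fibre K x"
    and fibre_minus: "a \<in> fibre K x \<Longrightarrow> - a \<in> fibre K x"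
  using subspace_fibre[OF assms]
  by (auto intro: scal.subspace_0 scal.subspace_add scal.subspace_scale scal.subspace_neg)

lemma coord_scale:
  assumes "(W, e) \<in> frames K" "x \<in> W" "a \<in> fibre K x"
  shows "coord K e j x (scal K c a) = c * coord K e j x a"
  unfolding coord_def
  using scal.representation_scale[OF independent_frame[OF assms(1,2)]] assms span_frame by simp

lemma coord_frame_sum:
  assumes "(W, e) \<in> frames K" "x \<in> W" "\<And>j. j < n \<Longrightarrow> b j \<in> fibre K x"
  shows "coord K e i x (\<Sum>j<n. scal K (c j) (b j)) = (\<Sum>j<n. c j * coord K e i x (b j))"
proof -
  have x: "x \<in> base K"
    using openin_frame[OF assms(1)] assms(2) openin_subset by blast
  have "coord K e i x (\<Sum>j<n. scal K (c j) (b j)) = (\<Sum>j<n. coord K e i x (scal K (c j) (b j)))"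
    unfolding coord_def
    using scal.representation_sum[OF independent_frame[OF assms(1,2)],
        of "{..<n}" "\<lambda>j. scal K (c j) (b j)"]
      assms x by (simp add: span_frame[OF assms(1,2)] fibre_scale)
  then show ?thesis using assms coord_scale by simp
qed

section \<open>Smooth local sections and their values\<close>

lemma smooth_section_base: "smooth_section K S s \<Longrightarrow> x \<in> S \<Longrightarrow> x \<in> base K"
  unfolding smooth_section_def using openin_subset by blast

lemma smooth_section_fibre: "smooth_section K S s \<Longrightarrow> x \<in> S \<Longrightarrow> s x \<in> fibre K x"
  unfolding smooth_section_def by blast

lemma section_nearI: "smooth_section K S s \<Longrightarrow> x \<in> S \<Longrightarrow> section_near K x s"
  unfolding section_near_def by blast

lemma smooth_section_scale:
  assumes "smooth_section K S s"
  shows "smooth_section K S (\<lambda>x. scal K c (s x))"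
  unfolding smooth_section_def
proof (intro conjI ballI, goal_cases)
  case 1
  then show ?case using assms by (simp add: smooth_section_def)
next
  case (2 x)
  then show ?case using assms fibre_scale smooth_section_base smooth_section_fibre by blast
next
  case (3 F)
  obtain W e where F: "F = (W, e)" by force
  have "smooth_fun K (S \<inter> W) (\<lambda>x. coord K e j x (scal K c (s x)))" if j: "j < rank K" for j
  \<comment> \<open>Homogeneity of \<open>coord\<close> is available only over the domain of its
    frame, so smoothness is carried over along an equality on \<open>S \<inter> W\<close>.\<close>
  proof (rule smooth_fun_cong[OF manifold])
    have "smooth_fun K (S \<inter> W) (\<lambda>x. coord K e j x (s x))"
      using assms 3 F j unfolding smooth_section_def by blast
    then show "smooth_fun K (S \<inter> W) (\<lambda>x. c * coord K e j x (s x))"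
      by (rule smooth_fun_bounded_linear[OF bounded_linear_mult_right])
    show "c * coord K e j x (s x) = coord K e j x (scal K c (s x))" if "x \<in> S \<inter> W" for x
      using coord_scale 3 F that assms smooth_section_fibre by simp
  qed
  then show ?case using F by simp
qed

lemma smooth_section_zero:
  assumes "smooth_section K S s"
  shows "smooth_section K S (\<lambda>x. 0)"
  using smooth_section_scale[OF assms, of 0] by simp

lemma smooth_section_minus:
  assumes "smooth_section K S s"
  shows "smooth_section K S (\<lambda>x. - s x)"
  using smooth_section_scale[OF assms, of "-1"] by simp

text \<open>Take constant coordinates in a frame around \<open>x\<close>; the coordinates in any
  other frame are then constant combinations of transition functions, hence smooth. The set
  \<open>S\<close> is chosen before \<open>a\<close>, so that two vectors extend to sections over
  the same domain.\<close>

lemma sections_through: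
  assumes x: "x \<in> base K"
  obtains S where "x \<in> S" "\<And>a. a \<in> fibre K x \<Longrightarrow> \<exists>s. smooth_section K S s \<and> s x = a"
proof -
  obtain W e where W: "(W, e) \<in> frames K" "x \<in> W"
    using frame_at[OF x] .
  have "\<exists>s. smooth_section K W s \<and> s x = a" if a: "a \<in> fibre K x" for a
  proof -
    define s where "s = (\<lambda>y. \<Sum>j<rank K. scal K (coord K e j x a) (e j y))"
    have e: "e j y \<in> fibre K y" if "j < rank K" "y \<in> W" for j y
      using span_frame[OF W(1) that(2)] that(1) scal.span_base[of "e j y" "(\<lambda>j. e j y) ` {..<rank K}"]
      by simp
    have "smooth_section K W s"
      unfolding smooth_section_def
    proof (intro conjI ballI, goal_cases)
      case 1
      then show ?case using openin_frame W by blast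
    next
      case (2 y)
      then have "y \<in> base K"
        using openin_frame[OF W(1)] openin_subset by blast
      then show ?case
        unfolding s_def using e 2 subspace_fibre
        by (intro scal.subspace_sum) (auto intro: fibre_scale)
    next
      case (3 F)
      obtain W' e' where F: "F = (W', e')" by force
      have "smooth_fun K (W \<inter> W') (\<lambda>y. coord K e' i y (s y))" if i: "i < rank K" for i
      proof (rule smooth_fun_cong[OF manifold])
        have "smooth_fun K (W \<inter> W') (\<lambda>y. coord K e' i y (e j y))" if "j < rank K" for j
          using smooth_fun_transition[of W' e' W e i j] 3 F W i that by (simp add: Int_commute)
        then show "smooth_fun K (W \<inter> W') (\<lambda>y. \<Sum>j<rank K. coord K e j x a * coord K e' i y (e j y))"
          using openin_frame W 3 F
          by (intro smooth_fun_sum smooth_fun_bounded_linear[OF bounded_linear_mult_right]) auto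
        show "(\<Sum>j<rank K. coord K e j x a * coord K e' i y (e j y)) = coord K e' i y (s y)"
          if "y \<in> W \<inter> W'" for y
          unfolding s_def using that e 3 F by (subst coord_frame_sum) auto
      qed
      then show ?case using F by simp
    qed
    moreover have "s x = a"
    proof -
      let ?B = "(\<lambda>j. e j x) ` {..<rank K}"
      \<comment> \<open>\<open>representation\<close> expands a vector over a set of basis vectors.
        Injectivity of the frame at \<open>x\<close> converts the indexed sum into a sum over that
        set.\<close>
      have "s x = (\<Sum>b\<in>?B. scal K (scal.representation ?B a b) b)"
        unfolding s_def coord_def by (subst sum.reindex[OF inj_frame[OF W]]) simp
      also have "\<dots> = a"
        using scal.sum_representation_eq[of ?B a ?B] independent_frame[OF W] span_frame[OF W] a by simp
      finally show ?thesis .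
    qed
    ultimately show ?thesis by blast
  qed
  then show ?thesis using that W by blast
qed

text \<open>By \<open>sections_through\<close> every fibre vector is a value of some section. A
  condition that sees a section only through its value at \<open>x\<close> is thus a condition on
  the fibre.\<close>

lemma all_sections_iff:
  "(\<forall>S s. smooth_section K S s \<longrightarrow> (\<forall>x\<in>S. P x (s x))) \<longleftrightarrow> (\<forall>x\<in>base K. \<forall>a\<in>fibre K x. P x a)"
proof (intro iffI ballI)
  fix x a
  assume *: "\<forall>S s. smooth_section K S s \<longrightarrow> (\<forall>x\<in>S. P x (s x))"
    and x: "x \<in> base K" and "a \<in> fibre K x"
  then show "P x a" using sections_through[OF x] by metis
qed (blast intro: smooth_section_base smooth_section_fibre)

lemma all_section_pairs_iff:
  "(\<forall>S s t. smooth_section K S s \<longrightarrow> smooth_section K S t \<longrightarrow> (\<forall>x\<in>S. P x (s x) (t x))) \<longleftrightarrow>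
     (\<forall>x\<in>base K. \<forall>a\<in>fibre K x. \<forall>b\<in>fibre K x. P x a b)"
proof (intro iffI ballI)
  fix x a b
  assume *: "\<forall>S s t. smooth_section K S s \<longrightarrow> smooth_section K S t \<longrightarrow> (\<forall>x\<in>S. P x (s x) (t x))"
    and x: "x \<in> base K" and ab: "a \<in> fibre K x" "b \<in> fibre K x"
  obtain S where S: "x \<in> S" "\<And>a. a \<in> fibre K x \<Longrightarrow> \<exists>s. smooth_section K S s \<and> s x = a"
    by (rule sections_through[OF x]) blast
  obtain s t where "smooth_section K S s" "s x = a" "smooth_section K S t" "t x = b"
    using S(2) ab by metis
  then show "P x a b" using * S(1) by blast
qed (blast intro: smooth_section_base smooth_section_fibre)

text \<open>A connection depends only on germs, and \<open>t\<close> may be arbitrary off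
  \<open>S\<close>. This freedom matters because the endomorphisms are controlled only at points of
  the base and on fibre vectors.\<close>

lemma connection_cong:
  assumes "smooth_connection K D" "v \<in> tangent K x" "smooth_section K S s" "x \<in> S"
    and "\<And>y. y \<in> S \<Longrightarrow> t y = s y"
  shows "D x v t = D x v s"
proof -
  have "\<forall>T t. x \<in> T \<longrightarrow> openin (mtop K) T \<longrightarrow> (\<forall>y\<in>T. s y = t y) \<longrightarrow> D x v s = D x v t"
    using assms(1,2) section_nearI[OF assms(3,4)] smooth_section_base[OF assms(3,4)]
    unfolding smooth_connection_def by blast
  moreover have "openin (mtop K) S"
    using assms(3) by (simp add: smooth_section_def)
  ultimately show ?thesis using assms(4,5) by metis
qed

lemma connection_fibre:
  assumes "smooth_connection K D" "v \<in> tangent K x" "smooth_section K S s" "x \<in> S"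
  shows "D x v s \<in> fibre K x"
  using assms(1,2) section_nearI[OF assms(3,4)] smooth_section_base[OF assms(3,4)]
  unfolding smooth_connection_def by blast

lemma connection_add:
  assumes "smooth_connection K D" "v \<in> tangent K x" "smooth_section K S s" "smooth_section K S t" "x \<in> S"
  shows "D x v (\<lambda>y. s y + t y) = D x v s + D x v t"
  using assms(1,2) section_nearI[OF assms(3,5)] section_nearI[OF assms(4,5)]
    smooth_section_base[OF assms(3,5)]
  unfolding smooth_connection_def by blast

lemma connection_zero:
  assumes "smooth_connection K D" "v \<in> tangent K x" "smooth_section K S s" "x \<in> S"
  shows "D x v (\<lambda>y. 0) = 0"
  using connection_add[OF assms(1,2) smooth_section_zero[OF assms(3)] smooth_section_zero[OF assms(3)] assms(4)]
  by simp

lemma connection_minus: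
  assumes "smooth_connection K D" "v \<in> tangent K x" "smooth_section K S s" "x \<in> S"
  shows "D x v (\<lambda>y. - s y) = - D x v s"
  using connection_add[OF assms(1,2,3) smooth_section_minus[OF assms(3)] assms(4)]
    connection_zero[OF assms] by (simp add: eq_neg_iff_add_eq_0 add.commute)

lemma fibre_linear_zero: "x \<in> base K \<Longrightarrow> fibre_linear K x L \<Longrightarrow> L 0 = 0"
  unfolding fibre_linear_def by (metis add.right_neutral add_cancel_right_right fibre_zero)

lemma fibre_antilinear_zero: "x \<in> base K \<Longrightarrow> fibre_antilinear K x L \<Longrightarrow> L 0 = 0"
  unfolding fibre_antilinear_def by (metis add.right_neutral add_cancel_right_right fibre_zero)

lemma fibre_linear_minus: "a \<in> fibre K x \<Longrightarrow> fibre_linear K x L \<Longrightarrow> L (- a) = - L a"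
  unfolding fibre_linear_def by (metis scal.scale_minus_left scal.scale_one)

lemma fibre_antilinear_minus: "a \<in> fibre K x \<Longrightarrow> fibre_antilinear K x L \<Longrightarrow> L (- a) = - L a"
proof -
  assume "a \<in> fibre K x" "fibre_antilinear K x L"
  then have "L (scal K (-1) a) = scal K (cnj (-1)) (L a)"
    unfolding fibre_antilinear_def by blast
  then show ?thesis by simp
qed

end


section \<open>The coefficients of the gauge equations\<close>

text \<open>The Saito operators send a section to a series in degrees 0 and -1 only. Hence at most
  two indices contribute to the coefficient of \<open>z^n\<close>, namely \<open>n\<close> and
  \<open>n + 1\<close>, and each only when it is a natural number.\<close>

lemma series_apply_eq:
  assumes "\<And>i. \<Psi> i x 0 = 0" "\<And>i. i \<noteq> 0 \<Longrightarrow> i \<noteq> - 1 \<Longrightarrow> s i x = 0"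
  shows "series_apply \<Psi> s n x = (if n \<ge> 0 then \<Psi> (nat n) x (s 0 x) else 0)
    + (if n \<ge> - 1 then \<Psi> (nat (n + 1)) x (s (- 1) x) else 0)"
proof -
  have "series_apply \<Psi> s n x = (\<Sum>i\<in>{i. int i = n \<or> int i = n + 1}. \<Psi> i x (s (n - int i) x))"
    unfolding series_apply_def
  proof (rule sum.mono_neutral_left)
    have "{i. int i = n \<or> int i = n + 1} \<subseteq> {nat n, nat (n + 1)}" by auto
    then show "finite {i. int i = n \<or> int i = n + 1}" by (rule finite_subset) simp
    show "{i. s (n - int i) x \<noteq> 0} \<subseteq> {i. int i = n \<or> int i = n + 1}"
    proof clarify
      fix i
      assume "s (n - int i) x \<noteq> 0" "int i \<noteq> n + 1"
      then show "int i = n" using assms(2)[of "n - int i"] by auto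
    qed
  qed (auto simp: assms(1))
  also have "\<dots> = (if n \<ge> 0 then \<Psi> (nat n) x (s 0 x) else 0)
    + (if n \<ge> - 1 then \<Psi> (nat (n + 1)) x (s (- 1) x) else 0)"
  proof -
    \<comment> \<open>The cases correspond to two, one or no admissible indices.\<close>
    consider "n \<ge> 0" | "n = - 1" | "n < - 1" by linarith
    then show ?thesis
    proof cases
      case 1
      then have "{i. int i = n \<or> int i = n + 1} = {nat n, nat (n + 1)}" by auto
      then show ?thesis using 1 by simp
    next
      case 2
      then have "{i. int i = n \<or> int i = n + 1} = {0}" by auto
      then show ?thesis using 2 by simp
    next
      case 3
      then have "{i. int i = n \<or> int i = n + 1} = {}" by auto
      then show ?thesis using 3 by (simp only: sum.empty) simp
    qed
  qed
  finally show ?thesis .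
qed

text \<open>A congruence modulo \<open>z^k\<close> constrains all degrees below \<open>k\<close>.
  Once the lower degrees agree, a single coefficient equation remains; here it sits in degree 0, and
  in the companion lemma for \<open>k = 2\<close> in degree 1.\<close>

lemma laurent_cong_1_iff:
  assumes "\<And>j x. j < 0 \<Longrightarrow> x \<in> S \<Longrightarrow> s j x = t j x"
  shows "laurent_cong 1 S s t \<longleftrightarrow> (\<forall>x\<in>S. s 0 x = t 0 x)"
proof -
  have "s j x = t j x" if "j < 1" "\<forall>x\<in>S. s 0 x = t 0 x" "x \<in> S" for j x
    using assms[of j x] that by (cases "j = 0") auto
  then show ?thesis unfolding laurent_cong_def by auto
qed

lemma laurent_cong_2_iff:
  assumes "\<And>j x. j < 1 \<Longrightarrow> x \<in> S \<Longrightarrow> s j x = t j x"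
  shows "laurent_cong 2 S s t \<longleftrightarrow> (\<forall>x\<in>S. s 1 x = t 1 x)"
proof -
  have "s j x = t j x" if "j < 2" "\<forall>x\<in>S. s 1 x = t 1 x" "x \<in> S" for j x
    using assms[of j x] that by (cases "j = 1") auto
  then show ?thesis unfolding laurent_cong_def by auto
qed

locale cv_saito = holo_bundle K for K :: "('m, 'v::ab_group_add) hbundle" +
  fixes C :: "('m, 'v) form" and \<U> :: "('m, 'v) endo" and g :: "'m \<Rightarrow> 'v \<Rightarrow> 'v \<Rightarrow> complex"
    and \<kappa> :: "('m, 'v) endo" and D :: "('m, 'v) conn" and \<Q> :: "('m, 'v) endo"
    and N :: "('m, 'v) conn" and \<V> :: "('m, 'v) endo"
  assumes cv: "cv_structure K C \<U> g \<kappa> D \<Q>"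
    and saito: "saito_structure K C \<U> g N \<V>"
begin

section \<open>Fibrewise algebra of the two structures\<close>

lemma common: "common_data K C \<U> g"
  using cv by (simp add: cv_structure_def)

lemma
  assumes "x \<in> base K"
  shows U_linear: "fibre_linear K x (\<U> x)"
    and V_linear: "fibre_linear K x (\<V> x)"
    and Q_linear: "fibre_linear K x (\<Q> x)"
    and C_linear: "v \<in> tangent10 K x \<Longrightarrow> fibre_linear K x (C x v)"
    and kappa_antilinear: "fibre_antilinear K x (\<kappa> x)"
proof -
  have "holo_endo K \<U>" "holo_endo_form K C" "holo_endo K \<V>" "smooth_endo K \<Q>"
    using cv saito common by (simp_all add: cv_structure_def saito_structure_def common_data_def)
  then show "fibre_linear K x (\<U> x)" "fibre_linear K x (\<V> x)" "fibre_linear K x (\<Q> x)"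
    "v \<in> tangent10 K x \<Longrightarrow> fibre_linear K x (C x v)"
    using assms by (simp_all add: holo_endo_def holo_endo_form_def smooth_endo_def)
  show "fibre_antilinear K x (\<kappa> x)"
    using cv assms by (simp add: cv_structure_def)
qed

lemma
  assumes "x \<in> base K" "a \<in> fibre K x"
  shows kappa_fibre: "\<kappa> x a \<in> fibre K x"
    and kappa_kappa: "\<kappa> x (\<kappa> x a) = a"
    and g_kappa: "b \<in> fibre K x \<Longrightarrow> g x (\<kappa> x a) (\<kappa> x b) = cnj (g x a b)"
    and g_sym: "b \<in> fibre K x \<Longrightarrow> g x a b = g x b a"
    and g_add: "a' \<in> fibre K x \<Longrightarrow> b \<in> fibre K x \<Longrightarrow> g x (a + a') b = g x a b + g x a' b"
    and g_scale: "b \<in> fibre K x \<Longrightarrow> g x (scal K c a) b = c * g x a b"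
    and g_nondegenerate: "(\<And>b. b \<in> fibre K x \<Longrightarrow> g x a b = 0) \<Longrightarrow> a = 0"
proof -
  show "\<kappa> x a \<in> fibre K x"
    using kappa_antilinear assms unfolding fibre_antilinear_def by blast
  show "\<kappa> x (\<kappa> x a) = a" "b \<in> fibre K x \<Longrightarrow> g x (\<kappa> x a) (\<kappa> x b) = cnj (g x a b)"
    using cv assms by (simp_all add: cv_structure_def)
  have "holo_symmetric_form K g" using common by (simp add: common_data_def)
  then show "b \<in> fibre K x \<Longrightarrow> g x a b = g x b a"
    "a' \<in> fibre K x \<Longrightarrow> b \<in> fibre K x \<Longrightarrow> g x (a + a') b = g x a b + g x a' b"
    "b \<in> fibre K x \<Longrightarrow> g x (scal K c a) b = c * g x a b"
    "(\<And>b. b \<in> fibre K x \<Longrightarrow> g x a b = 0) \<Longrightarrow> a = 0"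
    using assms by (simp_all add: holo_symmetric_form_def)
qed

lemma D_smooth: "smooth_connection K D" and D_dbar: "extends_dbar K D"
  using cv by (auto simp: cv_structure_def chern_connection_def)

lemma N_smooth: "smooth_connection K N" and N_dbar: "extends_dbar K N"
  using saito by (auto simp: saito_structure_def flat_holo_connection_def)

lemma
  assumes "vfield10 K S X" "x \<in> S"
  shows vfield10_tangent10: "X x \<in> tangent10 K x"
    and vfield10_tangent: "X x \<in> tangent K x"
    and vfield10_cnj_tangent: "cnj_field X x \<in> tangent K x"
  using assms cnj_vec_tangent[of "X x" K x]
  by (auto simp: vfield10_def smooth_vfield_def cnj_field_def)

text \<open>Both connections extend the same operator \<open>dbar K\<close>. This gives the
  (0,1)-part of \<open>D = N - [Ab, C]\<close>, and it lets \<open>dbar\<close> in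
  \<open>saito_nabla_bar\<close> be read as \<open>D\<close>, so that the induced derivative
  \<open>deriv_endo D\<close> of the gauge appears.\<close>

lemma
  assumes "vfield10 K S X" "smooth_section K S s" "x \<in> S"
  shows deriv_D_bar: "deriv_along D (cnj_field X) s x = deriv_along (dbar K) (cnj_field X) s x"
    and deriv_N_bar: "deriv_along N (cnj_field X) s x = deriv_along (dbar K) (cnj_field X) s x"
  using D_dbar N_dbar vfield10_tangent10[OF assms(1,3)] section_nearI[OF assms(2,3)]
    smooth_section_base[OF assms(2,3)]
  unfolding extends_dbar_def deriv_along_def cnj_field_def by blast+

lemma g_zero:
  assumes "x \<in> base K" "a \<in> fibre K x"
  shows "g x 0 a = 0" "g x a 0 = 0"
  using g_scale[of x a a 0] g_sym[of x a 0] assms by auto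

lemma g_minus:
  assumes "x \<in> base K" "a \<in> fibre K x" "b \<in> fibre K x"
  shows "g x (- a) b = - g x a b" "g x a (- b) = - g x a b"
  using g_scale[of x a b "-1"] g_scale[of x b a "-1"] g_sym[of x a b] g_sym[of x a "- b"]
    fibre_minus assms by auto

text \<open>Only pairs of nonnegative degrees with \<open>i + j = n + 1\<close> survive:
  \<open>(1, 0)\<close> and \<open>(0, 1)\<close> for \<open>n = 0\<close>, \<open>(0, 0)\<close>
  for \<open>n = - 1\<close>, and none below. The sign \<open>(-1)^j\<close> makes the two terms for
  \<open>n = 0\<close> enter with opposite signs, which is where symmetry of the first coefficient
  comes from.\<close>

lemma pairing_eq:
  assumes x: "x \<in> base K"
    and s: "\<And>i. s i x \<in> fibre K x" "\<And>i. i < 0 \<Longrightarrow> s i x = 0"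
    and t: "\<And>i. t i x \<in> fibre K x" "\<And>i. i < 0 \<Longrightarrow> t i x = 0"
    and n: "n \<le> 0"
  shows "pairing g w s t (n + w + 1) x =
    (if n = 0 then g x (s 1 x) (t 0 x) - g x (s 0 x) (t 1 x)
     else if n = - 1 then g x (s 0 x) (t 0 x) else 0)"
proof -
  let ?I = "{(i, j). i + j + w = n + w + 1 \<and> s i x \<noteq> 0 \<and> t j x \<noteq> 0}"
  \<comment> \<open>The support set in \<open>pairing\<close> may be enlarged to an explicit finite
    \<open>J\<close>, since \<open>g\<close> vanishes as soon as one argument is 0.\<close>
  have *: "pairing g w s t (n + w + 1) x = (\<Sum>(i, j)\<in>J. (- 1) powi j * g x (s i x) (t j x))"
    if "finite J" "\<And>i j. 0 \<le> i \<Longrightarrow> 0 \<le> j \<Longrightarrow> i + j = n + 1 \<Longrightarrow> (i, j) \<in> J"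
      "\<And>i j. (i, j) \<in> J \<Longrightarrow> i + j = n + 1" for J
    unfolding pairing_def
  proof (rule sum.mono_neutral_left)
    show "?I \<subseteq> J"
    proof clarify
      fix i j
      assume "i + j + w = n + w + 1" "s i x \<noteq> 0" "t j x \<noteq> 0"
      then show "(i, j) \<in> J"
        using that(2)[of i j] s(2)[of i] t(2)[of j] by linarith
    qed
    show "\<forall>p\<in>J - ?I. (case p of (i, j) \<Rightarrow> (- 1) powi j * g x (s i x) (t j x)) = 0"
    proof
      fix p
      assume p: "p \<in> J - ?I"
      obtain i j where ij: "p = (i, j)" by force
      then have "s i x = 0 \<or> t j x = 0"
        using that(3)[of i j] p by auto
      then show "(case p of (i, j) \<Rightarrow> (- 1) powi j * g x (s i x) (t j x)) = 0"
        unfolding ij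
        using g_zero[OF x] s(1)[of i] t(1)[of j] by auto
    qed
  qed (use that in auto)
  consider "n = 0" | "n = - 1" | "n < - 1" using n by linarith
  then show ?thesis
  proof cases
    case 1
    then show ?thesis by (subst *[of "{(1, 0), (0, 1)}"]) auto
  next
    case 2
    then show ?thesis by (subst *[of "{(0, 0)}"]) auto
  next
    case 3
    then show ?thesis by (subst *[of "{}"]) auto
  qed
qed

text \<open>\<open>T\<close> plays the role both of \<open>\<Psi>\<^sub>1\<close> and of \<open>- A\<^sup>\<flat>\<close>.\<close>

definition first_order_gauge :: "('m, 'v) endo \<Rightarrow> bool" where
  "first_order_gauge T \<longleftrightarrow> smooth_endo K T \<and>
     (\<forall>x\<in>base K. \<forall>a\<in>fibre K x. \<forall>b\<in>fibre K x. g x (T x a) b = g x a (T x b)) \<and>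
     (\<forall>x\<in>base K. \<forall>a\<in>fibre K x. \<Q> x a = \<V> x a + endo_comm \<U> T x a) \<and>
     (\<forall>S X s. vfield10 K S X \<longrightarrow> smooth_section K S s \<longrightarrow> (\<forall>x\<in>S.
        deriv_along D X s x = deriv_along N X s x + endo_comm T (along C X) x (s x) \<and>
        deriv_endo D (cnj_field X) T s x = - conjugate \<kappa> (along C X) x (s x)))"

section \<open>Coefficient comparison for a fixed series with constant term the identity\<close>

context
  fixes \<Psi> :: "nat \<Rightarrow> ('m, 'v) endo"
  assumes smooth: "\<And>i. smooth_endo K (\<Psi> i)"
    and Psi_0: "\<And>x a. x \<in> base K \<Longrightarrow> a \<in> fibre K x \<Longrightarrow> \<Psi> 0 x a = a"
begin

lemma Psi_linear: "x \<in> base K \<Longrightarrow> fibre_linear K x (\<Psi> i x)"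
  using smooth by (simp add: smooth_endo_def)

lemma Psi_zero: "x \<in> base K \<Longrightarrow> \<Psi> i x 0 = 0"
  using Psi_linear fibre_linear_zero by blast

lemma Psi_fibre: "x \<in> base K \<Longrightarrow> a \<in> fibre K x \<Longrightarrow> \<Psi> i x a \<in> fibre K x"
  using Psi_linear unfolding fibre_linear_def by blast

lemma Psi_section: "smooth_section K S a \<Longrightarrow> smooth_section K S (\<lambda>x. \<Psi> i x (a x))"
  using smooth by (simp add: smooth_endo_def smooth_map_def)

lemma series_apply_const:
  "x \<in> base K \<Longrightarrow>
     series_apply \<Psi> (laurent_const a) n x = (if n \<ge> 0 then \<Psi> (nat n) x (a x) else 0)"
  by (subst series_apply_eq) (auto simp: Psi_zero laurent_const_def)

lemma connection_series_apply_const: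
  assumes "smooth_connection K E" "v \<in> tangent K x" "smooth_section K S a" "x \<in> S"
  shows "E x v (series_apply \<Psi> (laurent_const a) n) =
    (if n \<ge> 0 then E x v (\<lambda>y. \<Psi> (nat n) y (a y)) else 0)"
proof (cases "n \<ge> 0")
  case True
  have "E x v (series_apply \<Psi> (laurent_const a) n) = E x v (\<lambda>y. \<Psi> (nat n) y (a y))"
    using True series_apply_const smooth_section_base[OF assms(3)]
    by (intro connection_cong[OF assms(1,2) Psi_section[OF assms(3)] assms(4)]) simp
  then show ?thesis using True by simp
next
  case False
  have "E x v (series_apply \<Psi> (laurent_const a) n) = E x v (\<lambda>y. 0)"
    using False series_apply_const smooth_section_base[OF assms(3)]
    by (intro connection_cong[OF assms(1,2) smooth_section_zero[OF assms(3)] assms(4)]) simp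
  then show ?thesis using False connection_zero[OF assms] by simp
qed

text \<open>In degree -1 both sides are \<open>C_X a\<close>, because \<open>\<Psi> 0\<close> is the
  identity on fibres. In degree 0 the equation is
  \<open>D_X a + C_X (\<Psi> 1 a) = N_X a + \<Psi> 1 (C_X a)\<close>, and the two
  \<open>C\<close>-terms form the commutator.\<close>

lemma nabla_z_iff:
  assumes X: "vfield10 K S X" and a: "smooth_section K S a"
  shows "laurent_cong 1 S (nabla_z C D X (series_apply \<Psi> (laurent_const a)))
           (series_apply \<Psi> (nabla_z C N X (laurent_const a))) \<longleftrightarrow>
         (\<forall>x\<in>S. deriv_along D X a x = deriv_along N X a x + endo_comm (\<Psi> 1) (along C X) x (a x))"
proof -
  let ?l = "nabla_z C D X (series_apply \<Psi> (laurent_const a))"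
  let ?r = "series_apply \<Psi> (nabla_z C N X (laurent_const a))"
  have l: "?l n x = (if n \<ge> 0 then D x (X x) (\<lambda>y. \<Psi> (nat n) y (a y)) else 0)
      + (if n \<ge> - 1 then C x (X x) (\<Psi> (nat (n + 1)) x (a x)) else 0)"
    and r: "?r n x = (if n \<ge> 0 then \<Psi> (nat n) x (N x (X x) a) else 0)
      + (if n \<ge> - 1 then \<Psi> (nat (n + 1)) x (C x (X x) (a x)) else 0)"
    and D0: "D x (X x) (\<lambda>y. \<Psi> 0 y (a y)) = D x (X x) a"
    and fibre: "a x \<in> fibre K x" "C x (X x) (a x) \<in> fibre K x" "N x (X x) a \<in> fibre K x"
    if x: "x \<in> S" for x n
  proof -
    have xb: "x \<in> base K" using smooth_section_base[OF a x] .
    have v: "X x \<in> tangent K x" using vfield10_tangent[OF X x] .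
    have lin: "fibre_linear K x (C x (X x))"
      using C_linear[OF xb vfield10_tangent10[OF X x]] .
    have C0: "C x (X x) 0 = 0" using fibre_linear_zero[OF xb lin] .
    show "?l n x = (if n \<ge> 0 then D x (X x) (\<lambda>y. \<Psi> (nat n) y (a y)) else 0)
      + (if n \<ge> - 1 then C x (X x) (\<Psi> (nat (n + 1)) x (a x)) else 0)"
      unfolding nabla_z_def deriv_along_def along_def
      using connection_series_apply_const[OF D_smooth v a x] series_apply_const[OF xb] C0 by auto
    show "?r n x = (if n \<ge> 0 then \<Psi> (nat n) x (N x (X x) a) else 0)
      + (if n \<ge> - 1 then \<Psi> (nat (n + 1)) x (C x (X x) (a x)) else 0)"
    proof -
      let ?s = "nabla_z C N X (laurent_const a)"
      have N0: "N x (X x) (\<lambda>y. 0) = 0" by (rule connection_zero[OF N_smooth v a x])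
      \<comment> \<open>A constant series is shifted only by the factor \<open>1/z\<close> in front
        of \<open>C_X\<close>, so nothing lies outside degrees 0 and -1.\<close>
      have "?s i x = 0" if "i \<noteq> 0" "i \<noteq> - 1" for i
        using that by (simp add: nabla_z_def laurent_const_def deriv_along_def along_def C0 N0 add_eq_0_iff2)
      moreover have "?s 0 x = N x (X x) a" "?s (- 1) x = C x (X x) (a x)"
        by (simp_all add: nabla_z_def laurent_const_def deriv_along_def along_def C0 N0)
      ultimately show ?thesis
        using series_apply_eq[of \<Psi> x ?s n, OF Psi_zero[OF xb]] by simp
    qed
    show "D x (X x) (\<lambda>y. \<Psi> 0 y (a y)) = D x (X x) a"
      by (rule connection_cong[OF D_smooth v a x])
        (simp add: Psi_0 smooth_section_base[OF a] smooth_section_fibre[OF a])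
    show "a x \<in> fibre K x" using smooth_section_fibre[OF a x] .
    then show "C x (X x) (a x) \<in> fibre K x"
      using lin unfolding fibre_linear_def by blast
    show "N x (X x) a \<in> fibre K x"
      using connection_fibre[OF N_smooth v a x] .
  qed
  have "laurent_cong 1 S ?l ?r \<longleftrightarrow> (\<forall>x\<in>S. ?l 0 x = ?r 0 x)"
  proof (rule laurent_cong_1_iff)
    show "?l n x = ?r n x" if "n < 0" "x \<in> S" for n x
      using that l r fibre Psi_0 smooth_section_base[OF a] by (cases "n = - 1") auto
  qed
  also have "\<dots> \<longleftrightarrow>
     (\<forall>x\<in>S. deriv_along D X a x = deriv_along N X a x + endo_comm (\<Psi> 1) (along C X) x (a x))"
    using l r fibre Psi_0 smooth_section_base[OF a] D0
    by (intro ball_cong) (auto simp: deriv_along_def along_def endo_comm_def algebra_simps)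
  finally show ?thesis .
qed

text \<open>The degree -1 terms are both \<open>\<U> a\<close>. In degree 0 the \<open>w/2\<close>
  terms cancel, leaving
  \<open>\<U> (\<Psi> 1 a) - \<Q> a = \<Psi> 1 (\<U> a) - \<V> a\<close>.\<close>

lemma nabla_U_iff:
  assumes a: "smooth_section K S a"
  shows "laurent_cong 1 S (cv_nabla_U K \<U> \<kappa> \<Q> w (series_apply \<Psi> (laurent_const a)))
           (series_apply \<Psi> (saito_nabla_U K \<U> \<V> w (laurent_const a))) \<longleftrightarrow>
         (\<forall>x\<in>S. \<Q> x (a x) = \<V> x (a x) + endo_comm \<U> (\<Psi> 1) x (a x))"
proof -
  let ?l = "cv_nabla_U K \<U> \<kappa> \<Q> w (series_apply \<Psi> (laurent_const a))"
  let ?r = "series_apply \<Psi> (saito_nabla_U K \<U> \<V> w (laurent_const a))"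
  \<comment> \<open>The bound \<open>n \<le> 0\<close> removes the term with
    \<open>z \<kappa> \<U> \<kappa>\<close>, whose first contribution is in degree 1.\<close>
  have l: "n \<le> 0 \<Longrightarrow> ?l n x = (if n \<ge> 0 then scal K (of_int n) (\<Psi> (nat n) x (a x)) - \<Q> x (\<Psi> (nat n) x (a x))
          + scal K (of_int w / 2) (\<Psi> (nat n) x (a x)) else 0)
      + (if n \<ge> - 1 then \<U> x (\<Psi> (nat (n + 1)) x (a x)) else 0)"
    and r: "?r n x = (if n \<ge> 0 then \<Psi> (nat n) x (scal K (of_int w / 2) (a x) - \<V> x (a x)) else 0)
      + (if n \<ge> - 1 then \<Psi> (nat (n + 1)) x (\<U> x (a x)) else 0)"
    and fibre: "x \<in> base K" "a x \<in> fibre K x" "\<U> x (a x) \<in> fibre K x"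
      "scal K (of_int w / 2) (a x) - \<V> x (a x) \<in> fibre K x"
    if x: "x \<in> S" for x n
  proof -
    show xb: "x \<in> base K" using smooth_section_base[OF a x] .
    note zero [simp] = fibre_linear_zero[OF xb U_linear[OF xb]] fibre_linear_zero[OF xb V_linear[OF xb]]
      fibre_linear_zero[OF xb Q_linear[OF xb]] fibre_antilinear_zero[OF xb kappa_antilinear[OF xb]]
    show "?l n x = (if n \<ge> 0 then scal K (of_int n) (\<Psi> (nat n) x (a x)) - \<Q> x (\<Psi> (nat n) x (a x))
          + scal K (of_int w / 2) (\<Psi> (nat n) x (a x)) else 0)
      + (if n \<ge> - 1 then \<U> x (\<Psi> (nat (n + 1)) x (a x)) else 0)" if "n \<le> 0"
      using that by (simp add: cv_nabla_U_def conjugate_def series_apply_const[OF xb])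
    show "?r n x = (if n \<ge> 0 then \<Psi> (nat n) x (scal K (of_int w / 2) (a x) - \<V> x (a x)) else 0)
      + (if n \<ge> - 1 then \<Psi> (nat (n + 1)) x (\<U> x (a x)) else 0)"
      by (subst series_apply_eq)
        (auto simp: saito_nabla_U_def laurent_const_def Psi_zero[OF xb] add.commute)
    show ax: "a x \<in> fibre K x" using smooth_section_fibre[OF a x] .
    show "\<U> x (a x) \<in> fibre K x"
      using U_linear[OF xb] ax unfolding fibre_linear_def by blast
    have "\<V> x (a x) \<in> fibre K x"
      using V_linear[OF xb] ax unfolding fibre_linear_def by blast
    then show "scal K (of_int w / 2) (a x) - \<V> x (a x) \<in> fibre K x"
      using scal.subspace_diff[OF subspace_fibre[OF xb]] fibre_scale[OF xb ax] by blast
  qed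
  have "laurent_cong 1 S ?l ?r \<longleftrightarrow> (\<forall>x\<in>S. ?l 0 x = ?r 0 x)"
  proof (rule laurent_cong_1_iff)
    show "?l n x = ?r n x" if "n < 0" "x \<in> S" for n x
      using that l r fibre Psi_0 by (cases "n = - 1") auto
  qed
  also have "\<dots> \<longleftrightarrow> (\<forall>x\<in>S. \<Q> x (a x) = \<V> x (a x) + endo_comm \<U> (\<Psi> 1) x (a x))"
    using l r fibre Psi_0
    by (intro ball_cong) (auto simp: endo_comm_def algebra_simps)
  finally show ?thesis .
qed

text \<open>There is no pole here, and the degree 0 terms agree because both connections have the
  same (0,1)-part. The conjugate of \<open>C\<close> carries a factor \<open>z\<close>, so the first
  real equation is in degree 1: this explains the congruence modulo \<open>z^2\<close>.\<close>

lemma nabla_bar_iff: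
  assumes X: "vfield10 K S X" and a: "smooth_section K S a"
  shows "laurent_cong 2 S (cv_nabla_bar C \<kappa> D X (series_apply \<Psi> (laurent_const a)))
           (series_apply \<Psi> (saito_nabla_bar K X (laurent_const a))) \<longleftrightarrow>
         (\<forall>x\<in>S. deriv_endo D (cnj_field X) (\<Psi> 1) a x = - conjugate \<kappa> (along C X) x (a x))"
proof -
  let ?l = "cv_nabla_bar C \<kappa> D X (series_apply \<Psi> (laurent_const a))"
  let ?r = "series_apply \<Psi> (saito_nabla_bar K X (laurent_const a))"
  let ?Y = "cnj_field X"
  have l: "?l n x = (if n \<ge> 0 then D x (?Y x) (\<lambda>y. \<Psi> (nat n) y (a y)) else 0)
      + (if n \<ge> 1 then conjugate \<kappa> (along C X) x (\<Psi> (nat (n - 1)) x (a x)) else 0)"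
    and r: "?r n x = (if n \<ge> 0 then \<Psi> (nat n) x (D x (?Y x) a) else 0)"
    and D0: "D x (?Y x) (\<lambda>y. \<Psi> 0 y (a y)) = D x (?Y x) a"
    and fibre: "x \<in> base K" "a x \<in> fibre K x" "D x (?Y x) a \<in> fibre K x"
    if x: "x \<in> S" for x n
  proof -
    show xb: "x \<in> base K" using smooth_section_base[OF a x] .
    have v: "?Y x \<in> tangent K x" using vfield10_cnj_tangent[OF X x] .
    have C0: "C x (X x) 0 = 0"
      using fibre_linear_zero[OF xb C_linear[OF xb vfield10_tangent10[OF X x]]] .
    have k0: "\<kappa> x 0 = 0" using fibre_antilinear_zero[OF xb kappa_antilinear[OF xb]] .
    show "?l n x = (if n \<ge> 0 then D x (?Y x) (\<lambda>y. \<Psi> (nat n) y (a y)) else 0)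
      + (if n \<ge> 1 then conjugate \<kappa> (along C X) x (\<Psi> (nat (n - 1)) x (a x)) else 0)"
      unfolding cv_nabla_bar_def deriv_along_def along_def conjugate_def
      using connection_series_apply_const[OF D_smooth v a x] series_apply_const[OF xb] C0 k0 by auto
    \<comment> \<open>The frame formula for \<open>dbar\<close> is not unfolded; its value on the
      zero section is read off from \<open>D\<close>.\<close>
    have "dbar K x (?Y x) (\<lambda>y. 0) = 0"
      using deriv_D_bar[OF X smooth_section_zero[OF a] x] connection_zero[OF D_smooth v a x]
      by (simp add: deriv_along_def)
    moreover have "dbar K x (?Y x) a = D x (?Y x) a"
      using deriv_D_bar[OF X a x] by (simp add: deriv_along_def)
    ultimately have "saito_nabla_bar K X (laurent_const a) i x = (if i = 0 then D x (?Y x) a else 0)" for i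
      by (simp add: saito_nabla_bar_def laurent_const_def deriv_along_def)
    then show "?r n x = (if n \<ge> 0 then \<Psi> (nat n) x (D x (?Y x) a) else 0)"
      using series_apply_eq[of \<Psi> x "saito_nabla_bar K X (laurent_const a)" n, OF Psi_zero[OF xb]]
        Psi_zero[OF xb] by simp
    show "D x (?Y x) (\<lambda>y. \<Psi> 0 y (a y)) = D x (?Y x) a"
      by (rule connection_cong[OF D_smooth v a x])
        (simp add: Psi_0 smooth_section_base[OF a] smooth_section_fibre[OF a])
    show "a x \<in> fibre K x" using smooth_section_fibre[OF a x] .
    show "D x (?Y x) a \<in> fibre K x"
      using connection_fibre[OF D_smooth v a x] .
  qed
  have "laurent_cong 2 S ?l ?r \<longleftrightarrow> (\<forall>x\<in>S. ?l 1 x = ?r 1 x)"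
  proof (rule laurent_cong_2_iff)
    show "?l n x = ?r n x" if "n < 1" "x \<in> S" for n x
      using that l r fibre Psi_0 D0 by (cases "n = 0") auto
  qed
  also have "\<dots> \<longleftrightarrow>
     (\<forall>x\<in>S. deriv_endo D ?Y (\<Psi> 1) a x = - conjugate \<kappa> (along C X) x (a x))"
    using l r fibre Psi_0
    by (intro ball_cong) (auto simp: deriv_along_def deriv_endo_def algebra_simps eq_neg_iff_add_eq_0)
  finally show ?thesis .
qed

text \<open>With the shift by \<open>w + 1\<close>, degree -1 compares \<open>g(a, b)\<close> with
  itself. In degree 0 the right side is 0 and the left side is
  \<open>g(\<Psi> 1 a, b) - g(a, \<Psi> 1 b)\<close>.\<close>

lemma pairing_iff:
  assumes a: "smooth_section K S a" and b: "smooth_section K S b"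
  shows "laurent_cong 1 S
           (\<lambda>n. pairing g w (series_apply \<Psi> (laurent_const a)) (series_apply \<Psi> (laurent_const b)) (n + w + 1))
           (\<lambda>n. pairing g w (laurent_const a) (laurent_const b) (n + w + 1)) \<longleftrightarrow>
         (\<forall>x\<in>S. g x (\<Psi> 1 x (a x)) (b x) = g x (a x) (\<Psi> 1 x (b x)))"
proof -
  let ?l = "\<lambda>n. pairing g w (series_apply \<Psi> (laurent_const a)) (series_apply \<Psi> (laurent_const b)) (n + w + 1)"
  let ?r = "\<lambda>n. pairing g w (laurent_const a) (laurent_const b) (n + w + 1)"
  have l: "?l n x = (if n = 0 then g x (\<Psi> 1 x (a x)) (b x) - g x (a x) (\<Psi> 1 x (b x))
      else if n = - 1 then g x (a x) (b x) else 0)"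
    and r: "?r n x = (if n = - 1 then g x (a x) (b x) else 0)"
    if x: "x \<in> S" and n: "n \<le> 0" for x n
  proof -
    have xb: "x \<in> base K" using smooth_section_base[OF a x] .
    have ab: "a x \<in> fibre K x" "b x \<in> fibre K x"
      using smooth_section_fibre a b x by blast+
    show "?l n x = (if n = 0 then g x (\<Psi> 1 x (a x)) (b x) - g x (a x) (\<Psi> 1 x (b x))
      else if n = - 1 then g x (a x) (b x) else 0)"
      by (subst pairing_eq[OF xb _ _ _ _ n])
        (simp_all add: series_apply_const[OF xb] Psi_fibre[OF xb] ab xb Psi_0)
    show "?r n x = (if n = - 1 then g x (a x) (b x) else 0)"
      by (subst pairing_eq[OF xb _ _ _ _ n]) (simp_all add: laurent_const_def ab xb g_zero)
  qed
  have "laurent_cong 1 S ?l ?r \<longleftrightarrow> (\<forall>x\<in>S. ?l 0 x = ?r 0 x)"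
    by (rule laurent_cong_1_iff) (simp only: l r order_less_imp_le, simp)
  also have "\<dots> \<longleftrightarrow> (\<forall>x\<in>S. g x (\<Psi> 1 x (a x)) (b x) = g x (a x) (\<Psi> 1 x (b x)))"
    by (rule ball_cong[OF refl]) (simp only: l r order_refl, simp)
  finally show ?thesis .
qed

text \<open>The equations for \<open>U\<close> and for the pairing are algebraic in the sections and
  become conditions on fibre vectors. Those for \<open>X\<close> and its conjugate differentiate the
  section, so they keep their quantifier over sections.\<close>

lemma gauge_conditions_iff:
  "(\<forall>S X a. vfield10 K S X \<longrightarrow> smooth_section K S a \<longrightarrow>
      laurent_cong 1 S (nabla_z C D X (series_apply \<Psi> (laurent_const a)))
        (series_apply \<Psi> (nabla_z C N X (laurent_const a)))) \<and>
   (\<forall>S a. smooth_section K S a \<longrightarrow>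
      laurent_cong 1 S (cv_nabla_U K \<U> \<kappa> \<Q> w (series_apply \<Psi> (laurent_const a)))
        (series_apply \<Psi> (saito_nabla_U K \<U> \<V> w (laurent_const a)))) \<and>
   (\<forall>S a b. smooth_section K S a \<longrightarrow> smooth_section K S b \<longrightarrow>
      laurent_cong 1 S
        (\<lambda>n. pairing g w (series_apply \<Psi> (laurent_const a)) (series_apply \<Psi> (laurent_const b)) (n + w + 1))
        (\<lambda>n. pairing g w (laurent_const a) (laurent_const b) (n + w + 1))) \<and>
   (\<forall>S X a. vfield10 K S X \<longrightarrow> smooth_section K S a \<longrightarrow>
      laurent_cong 2 S (cv_nabla_bar C \<kappa> D X (series_apply \<Psi> (laurent_const a)))
        (series_apply \<Psi> (saito_nabla_bar K X (laurent_const a)))) \<longleftrightarrow>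
   first_order_gauge (\<Psi> 1)"
proof -
  have U: "(\<forall>S a. smooth_section K S a \<longrightarrow>
      laurent_cong 1 S (cv_nabla_U K \<U> \<kappa> \<Q> w (series_apply \<Psi> (laurent_const a)))
        (series_apply \<Psi> (saito_nabla_U K \<U> \<V> w (laurent_const a)))) \<longleftrightarrow>
      (\<forall>x\<in>base K. \<forall>a\<in>fibre K x. \<Q> x a = \<V> x a + endo_comm \<U> (\<Psi> 1) x a)"
    by (simp add: nabla_U_iff all_sections_iff[symmetric])
  have P: "(\<forall>S a b. smooth_section K S a \<longrightarrow> smooth_section K S b \<longrightarrow>
      laurent_cong 1 S
        (\<lambda>n. pairing g w (series_apply \<Psi> (laurent_const a)) (series_apply \<Psi> (laurent_const b)) (n + w + 1))
        (\<lambda>n. pairing g w (laurent_const a) (laurent_const b) (n + w + 1))) \<longleftrightarrow>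
      (\<forall>x\<in>base K. \<forall>a\<in>fibre K x. \<forall>b\<in>fibre K x. g x (\<Psi> 1 x a) b = g x a (\<Psi> 1 x b))"
    by (simp add: pairing_iff all_section_pairs_iff[symmetric])
  show ?thesis
    unfolding U P first_order_gauge_def using smooth by (auto simp: nabla_z_iff nabla_bar_iff)
qed

end

lemma smooth_endo_id: "smooth_endo K (\<lambda>x a. a)"
  by (simp add: smooth_endo_def fibre_linear_def smooth_map_def)

lemma A_condition_iff_gauge:
  "A_condition K C \<U> g \<kappa> D \<Q> N \<V> w 1 \<longleftrightarrow> (\<exists>T. first_order_gauge T)"
proof
  assume "A_condition K C \<U> g \<kappa> D \<Q> N \<V> w 1"
  then show "\<exists>T. first_order_gauge T"
    unfolding A_condition_def
  proof (elim exE conjE, goal_cases)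
    case (1 \<Psi>)
    then have "first_order_gauge (\<Psi> 1)"
      by (subst gauge_conditions_iff[of \<Psi> w, symmetric]) simp_all
    then show ?case by blast
  qed
next
  assume "\<exists>T. first_order_gauge T"
  then obtain T where T: "first_order_gauge T" ..
  \<comment> \<open>The coefficients from \<open>\<Psi>\<^sub>2\<close> on are irrelevant; the identity is merely an available smooth endomorphism.\<close>
  define \<Psi> :: "nat \<Rightarrow> ('m, 'v) endo" where "\<Psi> = (\<lambda>i. if i = 1 then T else (\<lambda>x a. a))"
  have "smooth_endo K (\<Psi> i)" "\<Psi> 0 x a = a" "\<Psi> 1 = T" for i x a
    using T smooth_endo_id by (auto simp: \<Psi>_def first_order_gauge_def)
  then show "A_condition K C \<U> g \<kappa> D \<Q> N \<V> w 1"
    unfolding A_condition_def using gauge_conditions_iff[of \<Psi> w] T by (intro exI[of _ \<Psi>]) simp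
qed

section \<open>The potential\<close>

text \<open>By symmetry \<open>g(A a, \<kappa> b) = g(a, A \<kappa> b)\<close>, and since
  \<open>\<kappa>\<close> is an involution this is \<open>h(a, \<kappa> A \<kappa> b)\<close>.
  Nondegeneracy of \<open>g\<close> makes the adjoint vector unique, as the definite description
  requires.\<close>

lemma adjoint_eq:
  assumes x: "x \<in> base K" and b: "b \<in> fibre K x"
    and A: "fibre_linear K x (A x)"
    and sym: "\<And>a b. a \<in> fibre K x \<Longrightarrow> b \<in> fibre K x \<Longrightarrow> g x (A x a) b = g x a (A x b)"
  shows "adjoint_wrt K (herm g \<kappa>) A x b = \<kappa> x (A x (\<kappa> x b))"
  unfolding adjoint_wrt_def herm_def
proof (rule the_equality)
  have Ab: "A x (\<kappa> x b) \<in> fibre K x"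
    using A kappa_fibre[OF x b] unfolding fibre_linear_def by blast
  then show *: "\<kappa> x (A x (\<kappa> x b)) \<in> fibre K x \<and>
    (\<forall>a\<in>fibre K x. g x (A x a) (\<kappa> x b) = g x a (\<kappa> x (\<kappa> x (A x (\<kappa> x b)))))"
    using sym kappa_fibre[OF x] kappa_kappa[OF x] b by simp
  fix c
  assume c: "c \<in> fibre K x \<and> (\<forall>a\<in>fibre K x. g x (A x a) (\<kappa> x b) = g x a (\<kappa> x c))"
  have kc: "\<kappa> x c \<in> fibre K x" using c kappa_fibre[OF x] by blast
  \<comment> \<open>After applying \<open>\<kappa>\<close>, the difference of the two candidates is
    \<open>g\<close>-orthogonal to the whole fibre.\<close>
  have "\<kappa> x c + - A x (\<kappa> x b) = 0"
  proof (rule g_nondegenerate[OF x])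
    show "\<kappa> x c + - A x (\<kappa> x b) \<in> fibre K x"
      using kc Ab x by (intro fibre_add fibre_minus)
    fix a
    assume a: "a \<in> fibre K x"
    have "g x (\<kappa> x c) a = g x (A x (\<kappa> x b)) a"
      using c a kc Ab sym kappa_fibre[OF x b] g_sym[OF x] by metis
    then show "g x (\<kappa> x c + - A x (\<kappa> x b)) a = 0"
      using g_add[OF x kc fibre_minus[OF x Ab] a] g_minus[OF x Ab a] by simp
  qed
  then have "\<kappa> x (\<kappa> x c) = \<kappa> x (A x (\<kappa> x b))"
    by simp
  then show "c = \<kappa> x (A x (\<kappa> x b))"
    using c kappa_kappa[OF x] by simp
qed

text \<open>The two antilinear factors \<open>\<kappa>\<close> compose with \<open>A\<close> to a
  linear map, and each factor preserves smooth sections.\<close>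

lemma smooth_endo_conjugate_minus:
  assumes "smooth_endo K A"
  shows "smooth_endo K (\<lambda>x a. - \<kappa> x (A x (\<kappa> x a)))"
  unfolding smooth_endo_def
proof (intro conjI ballI)
  fix x
  assume x: "x \<in> base K"
  have A: "fibre_linear K x (A x)"
    using assms x by (simp add: smooth_endo_def)
  show "fibre_linear K x (\<lambda>a. - \<kappa> x (A x (\<kappa> x a)))"
    using A kappa_antilinear[OF x] fibre_minus[OF x]
    unfolding fibre_linear_def fibre_antilinear_def by simp
next
  have "smooth_map K \<kappa>" using cv by (simp add: cv_structure_def)
  then show "smooth_map K (\<lambda>x a. - \<kappa> x (A x (\<kappa> x a)))"
    using assms smooth_section_minus unfolding smooth_endo_def smooth_map_def by simp
qed

text \<open>Compatibility of \<open>g\<close> with \<open>\<kappa>\<close> turns the claim into the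
  complex conjugate of the symmetry of \<open>A\<close> on \<open>\<kappa> a\<close> and
  \<open>\<kappa> b\<close>.\<close>

lemma symmetric_conjugate_minus:
  assumes x: "x \<in> base K" and ab: "a \<in> fibre K x" "b \<in> fibre K x"
    and A: "fibre_linear K x (A x)"
    and sym: "\<And>a b. a \<in> fibre K x \<Longrightarrow> b \<in> fibre K x \<Longrightarrow> g x (A x a) b = g x a (A x b)"
  shows "g x (- \<kappa> x (A x (\<kappa> x a))) b = g x a (- \<kappa> x (A x (\<kappa> x b)))"
proof -
  have *: "A x (\<kappa> x c) \<in> fibre K x" if "c \<in> fibre K x" for c
    using A kappa_fibre[OF x that] unfolding fibre_linear_def by blast
  have "g x (\<kappa> x (A x (\<kappa> x a))) b = g x (\<kappa> x (A x (\<kappa> x a))) (\<kappa> x (\<kappa> x b))"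
    using kappa_kappa[OF x] ab by simp
  also have "\<dots> = cnj (g x (A x (\<kappa> x a)) (\<kappa> x b))"
    using g_kappa[OF x] * ab kappa_fibre[OF x] by blast
  also have "\<dots> = cnj (g x (\<kappa> x a) (A x (\<kappa> x b)))"
    using sym ab kappa_fibre[OF x] by simp
  also have "\<dots> = g x (\<kappa> x (\<kappa> x a)) (\<kappa> x (A x (\<kappa> x b)))"
    using g_kappa[OF x] * ab kappa_fibre[OF x] by simp
  also have "\<dots> = g x a (\<kappa> x (A x (\<kappa> x b)))"
    using kappa_kappa[OF x] ab by simp
  finally show ?thesis
    using g_minus[OF x] * ab kappa_fibre[OF x] by simp
qed

text \<open>On fibres the adjoint of \<open>A\<close> is \<open>- T\<close>, and all the equations
  are affine in the potential, so passing from one to the other only changes signs. Taking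
  \<open>A\<close> and \<open>T\<close> as a related pair lets the equivalence be used starting from
  either of them.\<close>

lemma potential_iff_gauge:
  assumes A: "smooth_endo K A"
    and A_sym: "\<And>x a b. x \<in> base K \<Longrightarrow> a \<in> fibre K x \<Longrightarrow> b \<in> fibre K x \<Longrightarrow> g x (A x a) b = g x a (A x b)"
    and T: "smooth_endo K T"
    and T_sym: "\<And>x a b. x \<in> base K \<Longrightarrow> a \<in> fibre K x \<Longrightarrow> b \<in> fibre K x \<Longrightarrow> g x (T x a) b = g x a (T x b)"
    and TA: "\<And>x a. x \<in> base K \<Longrightarrow> a \<in> fibre K x \<Longrightarrow> T x a = - \<kappa> x (A x (\<kappa> x a))"
  shows "(let Ab = adjoint_wrt K (herm g \<kappa>) A in
          (\<forall>S X s. vfield10 K S X \<longrightarrow> smooth_section K S s \<longrightarrow> (\<forall>x\<in>S.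
             deriv_along D X s x = deriv_along N X s x - endo_comm Ab (along C X) x (s x) \<and>
             deriv_along D (cnj_field X) s x = deriv_along N (cnj_field X) s x \<and>
             deriv_endo D (cnj_field X) Ab s x = conjugate \<kappa> (along C X) x (s x))) \<and>
          (\<forall>x\<in>base K. \<forall>a\<in>fibre K x. \<Q> x a = \<V> x a - endo_comm \<U> Ab x a)) \<longleftrightarrow>
         first_order_gauge T"
proof -
  define Ab where "Ab = adjoint_wrt K (herm g \<kappa>) A"
  have Ab: "Ab x a = - T x a" if "x \<in> base K" "a \<in> fibre K x" for x a
    using adjoint_eq[OF that] A A_sym that TA by (simp add: Ab_def smooth_endo_def)
  have T_fibre: "T x a \<in> fibre K x" if "x \<in> base K" "a \<in> fibre K x" for x a
    using T that unfolding smooth_endo_def fibre_linear_def by blast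
  have comm: "endo_comm Ab L x a = - endo_comm T L x a" "endo_comm L Ab x a = - endo_comm L T x a"
    if x: "x \<in> base K" and a: "a \<in> fibre K x" and L: "fibre_linear K x (L x)" for L x a
  proof -
    have "L x a \<in> fibre K x" using L a unfolding fibre_linear_def by blast
    then show "endo_comm Ab L x a = - endo_comm T L x a" "endo_comm L Ab x a = - endo_comm L T x a"
      using fibre_linear_minus[OF T_fibre[OF x a] L] by (simp_all add: endo_comm_def Ab[OF x] a)
  qed
  have deriv: "deriv_endo D (cnj_field X) Ab s x = - deriv_endo D (cnj_field X) T s x"
    if X: "vfield10 K S X" and s: "smooth_section K S s" and x: "x \<in> S" for S X s x
  proof -
    have v: "cnj_field X x \<in> tangent K x" using vfield10_cnj_tangent[OF X x] .
    have Ts: "smooth_section K S (\<lambda>y. T y (s y))"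
      using T s by (simp add: smooth_endo_def smooth_map_def)
    \<comment> \<open>\<open>Ab\<close> and \<open>- T\<close> are known to agree only on fibres
      over the base, so the replacement under the derivative goes through locality of
      \<open>D\<close>.\<close>
    have "D x (cnj_field X x) (\<lambda>y. Ab y (s y)) = D x (cnj_field X x) (\<lambda>y. - T y (s y))"
      by (rule connection_cong[OF D_smooth v smooth_section_minus[OF Ts] x])
        (simp add: Ab smooth_section_base[OF s] smooth_section_fibre[OF s])
    also have "\<dots> = - D x (cnj_field X x) (\<lambda>y. T y (s y))"
      by (rule connection_minus[OF D_smooth v Ts x])
    finally show ?thesis
      using Ab[OF smooth_section_base[OF s x] connection_fibre[OF D_smooth v s x]]
      by (simp add: deriv_endo_def deriv_along_def)
  qed
  have "deriv_along D X s x = deriv_along N X s x - endo_comm Ab (along C X) x (s x) \<and>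
        deriv_along D (cnj_field X) s x = deriv_along N (cnj_field X) s x \<and>
        deriv_endo D (cnj_field X) Ab s x = conjugate \<kappa> (along C X) x (s x) \<longleftrightarrow>
        deriv_along D X s x = deriv_along N X s x + endo_comm T (along C X) x (s x) \<and>
        deriv_endo D (cnj_field X) T s x = - conjugate \<kappa> (along C X) x (s x)"
    if X: "vfield10 K S X" and s: "smooth_section K S s" and x: "x \<in> S" for S X s x
  proof -
    have minus: "- u = v \<longleftrightarrow> u = - v" for u v :: 'v by auto
    have xb: "x \<in> base K" using smooth_section_base[OF s x] .
    have "fibre_linear K x (along C X x)"
      using C_linear[OF xb vfield10_tangent10[OF X x]] by (simp add: along_def)
    then show ?thesis
      using comm(1)[OF xb smooth_section_fibre[OF s x]] deriv[OF X s x]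
        deriv_D_bar[OF X s x] deriv_N_bar[OF X s x]
      by (simp add: minus)
  qed
  moreover have "\<Q> x a = \<V> x a - endo_comm \<U> Ab x a \<longleftrightarrow> \<Q> x a = \<V> x a + endo_comm \<U> T x a"
    if "x \<in> base K" "a \<in> fibre K x" for x a
    using comm(2)[OF that] U_linear[OF that(1)] by simp
  ultimately show ?thesis
    unfolding first_order_gauge_def Let_def Ab_def[symmetric] using T T_sym by (simp add: conj_commute)
qed

lemma potential_iff_ex_gauge:
  "harmonic_potential_real_saito K C \<U> g \<kappa> D \<Q> N \<V> \<longleftrightarrow> (\<exists>T. first_order_gauge T)"
proof
  assume "harmonic_potential_real_saito K C \<U> g \<kappa> D \<Q> N \<V>"
  then obtain A where A: "smooth_endo K A"
    "\<And>x a b. x \<in> base K \<Longrightarrow> a \<in> fibre K x \<Longrightarrow> b \<in> fibre K x \<Longrightarrow> g x (A x a) b = g x a (A x b)"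
    and pot: "let Ab = adjoint_wrt K (herm g \<kappa>) A in
          (\<forall>S X s. vfield10 K S X \<longrightarrow> smooth_section K S s \<longrightarrow> (\<forall>x\<in>S.
             deriv_along D X s x = deriv_along N X s x - endo_comm Ab (along C X) x (s x) \<and>
             deriv_along D (cnj_field X) s x = deriv_along N (cnj_field X) s x \<and>
             deriv_endo D (cnj_field X) Ab s x = conjugate \<kappa> (along C X) x (s x))) \<and>
          (\<forall>x\<in>base K. \<forall>a\<in>fibre K x. \<Q> x a = \<V> x a - endo_comm \<U> Ab x a)"
    unfolding harmonic_potential_real_saito_def by blast
  have lin: "fibre_linear K x (A x)" if "x \<in> base K" for x
    using A that by (simp add: smooth_endo_def)
  let ?T = "\<lambda>x a. - \<kappa> x (A x (\<kappa> x a))"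
  have sym: "g x (?T x a) b = g x a (?T x b)" if "x \<in> base K" "a \<in> fibre K x" "b \<in> fibre K x" for x a b
    using symmetric_conjugate_minus[OF that, of A] lin A(2) that by blast
  have "first_order_gauge ?T"
    using pot potential_iff_gauge[OF A smooth_endo_conjugate_minus[OF A(1)] sym] by blast
  then show "\<exists>T. first_order_gauge T" by blast
next
  assume "\<exists>T. first_order_gauge T"
  then obtain T where gauge: "first_order_gauge T" ..
  then have T: "smooth_endo K T"
    "\<And>x a b. x \<in> base K \<Longrightarrow> a \<in> fibre K x \<Longrightarrow> b \<in> fibre K x \<Longrightarrow> g x (T x a) b = g x a (T x b)"
    unfolding first_order_gauge_def by blast+
  have lin: "fibre_linear K x (T x)" if "x \<in> base K" for x
    using T that by (simp add: smooth_endo_def)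
  \<comment> \<open>The assignment \<open>A \<mapsto> - \<kappa> A \<kappa>\<close> is an involution
    on fibres, so the potential is recovered from \<open>T\<close> by the formula that produced
    \<open>T\<close> from \<open>A\<close>.\<close>
  define A :: "('m, 'v) endo" where "A = (\<lambda>x a. - \<kappa> x (T x (\<kappa> x a)))"
  have A: "smooth_endo K A"
    unfolding A_def by (rule smooth_endo_conjugate_minus[OF T(1)])
  have A_sym: "g x (A x a) b = g x a (A x b)"
    if "x \<in> base K" "a \<in> fibre K x" "b \<in> fibre K x" for x a b
    unfolding A_def using symmetric_conjugate_minus[OF that, of T] lin T(2) that by blast
  \<comment> \<open>The inner minus sign passes through the antilinear \<open>\<kappa>\<close>,
    since -1 is real, and cancels the outer one.\<close>
  have TA: "T x a = - \<kappa> x (A x (\<kappa> x a))" if x: "x \<in> base K" and a: "a \<in> fibre K x" for x a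
  proof -
    have Ta: "T x a \<in> fibre K x" using lin[OF x] a unfolding fibre_linear_def by blast
    show ?thesis
      using fibre_antilinear_minus[OF kappa_fibre[OF x Ta] kappa_antilinear[OF x]]
      by (simp add: A_def kappa_kappa[OF x] a Ta)
  qed
  show "harmonic_potential_real_saito K C \<U> g \<kappa> D \<Q> N \<V>"
    unfolding harmonic_potential_real_saito_def
    using A A_sym potential_iff_gauge[OF A A_sym T TA] gauge by blast
qed

end

theorem proposition2p20:
  fixes K :: "('m, 'v::ab_group_add) hbundle"
    and C :: "('m, 'v) form" and \<U> :: "('m, 'v) endo" and g :: "'m \<Rightarrow> 'v \<Rightarrow> 'v \<Rightarrow> complex"
    and \<kappa> :: "('m, 'v) endo" and D :: "('m, 'v) conn" and \<Q> :: "('m, 'v) endo"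
    and N :: "('m, 'v) conn" and \<V> :: "('m, 'v) endo" and w :: int
  assumes "cv_structure K C \<U> g \<kappa> D \<Q>"
    and "saito_structure K C \<U> g N \<V>"
  shows "harmonic_potential_real_saito K C \<U> g \<kappa> D \<Q> N \<V> \<longleftrightarrow>
         A_condition K C \<U> g \<kappa> D \<Q> N \<V> w 1"
proof -
  interpret cv_saito K C \<U> g \<kappa> D \<Q> N \<V>
    using assms by unfold_locales (auto simp: cv_structure_def common_data_def)
  show ?thesis
    by (simp only: potential_iff_ex_gauge A_condition_iff_gauge)
qed

end
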